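(* Let $n\ge 2$ and let $P\subseteq\mathbb{R}^n$ be a polytope having at least one edge. Let $s$ denote the expected number of vertices of a uniformly random shadow of $P$, let $\operatorname{gdiam}(P)$ be the geometric diameter of $P$, and let $m$ and $M$ be the minimal and maximal Euclidean lengths of edges of $P$, respectively. Then \[ \frac{2}{M}\operatorname{gdiam}(P)\;\le\; s\;\le\; \frac{O(\sqrt{n})\,\pi}{2m}\operatorname{gdiam}(P),\] where the $O(\sqrt n)$ term is bounded by $c\sqrt n$ for an absolute constant $c$ independent of $P$ and $n$.
   Context: A uniformly random shadow of $P$ is the image $\pi(P)$ under the map $\pi(x)=(U^{\intercal}x,V^{\intercal}x)$, where $(U,V)$ is a uniformly random pair of unit vectors in $\mathbb{R}^n$ with $U^{\intercal}V=0$ (a uniformly random orthonormal $2$-frame). The geometric diameter $\operatorname{gdiam}(P)$ is $\max_{x,y\in P}\|x-y\|_2$. *)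

theory Defs
  imports "HOL-Probability.Probability"
begin

text \<open>
  The constant in the upper bound does not depend on the dimension, so the dimension has to be
  quantified inside the statement and cannot be a type. All spaces \<open>\<real>\<^sup>n\<close> are therefore taken inside
  the inner product space of finitely supported real sequences, \<open>\<real>\<^sup>n\<close> being the sequences that
  vanish from index \<open>n\<close> on; the norm is the Euclidean one.
\<close>

typedef fin_seq = "{x :: nat \<Rightarrow> real. finite {i. x i \<noteq> 0}}"
  morphisms coord Fin_Seq
  by (rule exI[of _ "\<lambda>_. 0"]) simp

setup_lifting type_definition_fin_seq

lemma finite_support: "finite {i. coord x i \<noteq> 0}"
  using coord[of x] by simp

lemma fin_seq_eqI: "(\<And>i. coord x i = coord y i) \<Longrightarrow> x = y"
  by (simp add: coord_inject[symmetric] fun_eq_iff)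

instantiation fin_seq :: real_vector
begin

lift_definition zero_fin_seq :: fin_seq is "\<lambda>_. 0"
  by simp

lift_definition plus_fin_seq :: "fin_seq \<Rightarrow> fin_seq \<Rightarrow> fin_seq" is "\<lambda>x y i. x i + y i"
  subgoal for x y by (rule finite_subset[of _ "{i. x i \<noteq> 0} \<union> {i. y i \<noteq> 0}"]) auto
  done

lift_definition minus_fin_seq :: "fin_seq \<Rightarrow> fin_seq \<Rightarrow> fin_seq" is "\<lambda>x y i. x i - y i"
  subgoal for x y by (rule finite_subset[of _ "{i. x i \<noteq> 0} \<union> {i. y i \<noteq> 0}"]) auto
  done

lift_definition uminus_fin_seq :: "fin_seq \<Rightarrow> fin_seq" is "\<lambda>x i. - x i"
  by simp

lift_definition scaleR_fin_seq :: "real \<Rightarrow> fin_seq \<Rightarrow> fin_seq" is "\<lambda>r x i. r * x i"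
  by (erule finite_subset[rotated]) auto

instance
  by standard (transfer; simp add: fun_eq_iff algebra_simps)+

end

instantiation fin_seq :: real_inner
begin

definition inner_fin_seq :: "fin_seq \<Rightarrow> fin_seq \<Rightarrow> real" where
  "inner (x :: fin_seq) y = (\<Sum>i\<in>{i. coord x i \<noteq> 0}. coord x i * coord y i)"

definition norm_fin_seq :: "fin_seq \<Rightarrow> real" where
  "norm (x :: fin_seq) = sqrt (inner x x)"

definition dist_fin_seq :: "fin_seq \<Rightarrow> fin_seq \<Rightarrow> real" where
  "dist (x :: fin_seq) y = norm (x - y)"

definition sgn_fin_seq :: "fin_seq \<Rightarrow> fin_seq" where
  "sgn (x :: fin_seq) = x /\<^sub>R norm x"

definition uniformity_fin_seq :: "(fin_seq \<times> fin_seq) filter" where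
  "uniformity = (INF e\<in>{0<..}. principal {(x :: fin_seq, y). dist x y < e})"

definition open_fin_seq :: "fin_seq set \<Rightarrow> bool" where
  "open (U :: fin_seq set) \<longleftrightarrow> (\<forall>x\<in>U. \<forall>\<^sub>F (x', y) in uniformity. x' = x \<longrightarrow> y \<in> U)"

lemma inner_fin_seq_superset:
  assumes "finite A" "{i. coord x i \<noteq> 0} \<subseteq> A"
  shows "inner x y = (\<Sum>i\<in>A. coord x i * coord y i)"
  unfolding inner_fin_seq_def
  by (rule sum.mono_neutral_left) (use assms in auto)

instance
proof
  fix x y z :: fin_seq and r :: real
  let ?A = "{i. coord x i \<noteq> 0} \<union> {i. coord y i \<noteq> 0}"
  have A: "finite ?A"
    by (simp add: finite_support)
  have supp_add: "{i. coord (x + y) i \<noteq> 0} \<subseteq> ?A"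
    by (auto simp: plus_fin_seq.rep_eq)
  have supp_scale: "{i. coord (r *\<^sub>R x) i \<noteq> 0} \<subseteq> {i. coord x i \<noteq> 0}"
    by (auto simp: scaleR_fin_seq.rep_eq)
  show "inner x y = inner y x"
    using inner_fin_seq_superset[OF A, of x y] inner_fin_seq_superset[OF A, of y x]
    by (simp add: mult.commute)
  show "inner (x + y) z = inner x z + inner y z"
    using inner_fin_seq_superset[OF A supp_add, of z] inner_fin_seq_superset[OF A, of x z]
      inner_fin_seq_superset[OF A, of y z]
    by (simp add: plus_fin_seq.rep_eq algebra_simps sum.distrib)
  show "inner (r *\<^sub>R x) y = r * inner x y"
    using inner_fin_seq_superset[OF finite_support supp_scale, of y]
    by (simp add: inner_fin_seq_def scaleR_fin_seq.rep_eq sum_distrib_left mult.assoc)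
  show "0 \<le> inner x x"
    by (simp add: inner_fin_seq_def sum_nonneg)
  show "inner x x = 0 \<longleftrightarrow> x = 0"
  proof
    assume "inner x x = 0"
    then have "\<forall>i\<in>{i. coord x i \<noteq> 0}. coord x i * coord x i = 0"
      unfolding inner_fin_seq_def
      by (subst (asm) sum_nonneg_eq_0_iff) (auto simp: finite_support)
    then show "x = 0"
      by (intro fin_seq_eqI) (auto simp: zero_fin_seq.rep_eq)
  qed (simp add: inner_fin_seq_def zero_fin_seq.rep_eq)
qed (simp_all only: norm_fin_seq_def dist_fin_seq_def sgn_fin_seq_def uniformity_fin_seq_def
    open_fin_seq_def)

end

definition R_space :: "nat \<Rightarrow> fin_seq set" where
  "R_space n = {x. \<forall>i\<ge>n. coord x i = 0}"

lemma inner_R_space: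
  assumes "x \<in> R_space n"
  shows "inner x y = (\<Sum>i<n. coord x i * coord y i)"
  by (rule inner_fin_seq_superset) (use assms in \<open>auto simp: R_space_def not_less[symmetric]\<close>)

text \<open>
  The affine dimension of the library is restricted to \<^class>\<open>euclidean_space\<close>; the second conjunct
  is its definition, unfolded for the value 1.
\<close>

definition is_edge_of :: "'a::real_vector set \<Rightarrow> 'a set \<Rightarrow> bool" where
  "is_edge_of e P \<longleftrightarrow> e face_of P \<and>
     (\<exists>B. affine hull B = affine hull e \<and> \<not> affine_dependent B \<and> card B = 2)"

lemma is_edge_of_iff_edge_of:
  fixes e P :: "'a::euclidean_space set"
  shows "is_edge_of e P \<longleftrightarrow> e edge_of P"
proof -
  have "aff_dim e = 1 \<longleftrightarrow> (\<exists>B. affine hull B = affine hull e \<and> \<not> affine_dependent B \<and> card B = 2)"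
  proof
    assume "aff_dim e = 1"
    moreover obtain B where "affine hull B = affine hull e" "\<not> affine_dependent B"
        "int (card B) = aff_dim e + 1"
      using aff_dim_basis_exists by blast
    ultimately show "\<exists>B. affine hull B = affine hull e \<and> \<not> affine_dependent B \<and> card B = 2"
      by (intro exI[of _ B]) auto
  next
    assume "\<exists>B. affine hull B = affine hull e \<and> \<not> affine_dependent B \<and> card B = 2"
    then show "aff_dim e = 1"
      by (metis aff_dim_affine_hull aff_dim_unique add_diff_cancel_right' of_nat_numeral
          one_add_one aff_dim_affine_independent diff_add_cancel)
  qed
  then show ?thesis
    by (simp add: is_edge_of_def edge_of_def)
qed

text \<open>An edge of a polytope is a segment, so its diameter is the distance of its endpoints.\<close>

definition edge_lengths :: "'a::real_normed_vector set \<Rightarrow> real set" where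
  "edge_lengths P = diameter ` {e. is_edge_of e P}"

definition orthonormal_2_frames :: "nat \<Rightarrow> (fin_seq \<times> fin_seq) set" where
  "orthonormal_2_frames n =
     {(u, v). u \<in> R_space n \<and> v \<in> R_space n \<and> norm u = 1 \<and> norm v = 1 \<and> inner u v = 0}"

text \<open>
  The uniform distribution on orthonormal 2-frames of \<open>\<real>\<^sup>n\<close>: the (unique) Borel probability measure
  that is invariant under the orthogonal group. Every orthogonal map of \<open>\<real>\<^sup>n\<close> is the restriction of
  an orthogonal transformation of the ambient space, extending it by the identity on the
  remaining coordinates.
\<close>

definition uniform_2_frame :: "nat \<Rightarrow> (fin_seq \<times> fin_seq) measure \<Rightarrow> bool" where
  "uniform_2_frame n \<mu> \<longleftrightarrow>
     prob_space \<mu> \<and>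
     space \<mu> = orthonormal_2_frames n \<and>
     sets \<mu> = sets (restrict_space borel (orthonormal_2_frames n)) \<and>
     (\<forall>T. orthogonal_transformation T \<and> T ` R_space n = R_space n
        \<longrightarrow> distr \<mu> \<mu> (map_prod T T) = \<mu>)"

definition shadow :: "fin_seq set \<Rightarrow> fin_seq \<times> fin_seq \<Rightarrow> (real \<times> real) set" where
  "shadow P = (\<lambda>(u, v). (\<lambda>x. (inner u x, inner v x)) ` P)"

definition expected_shadow_vertices :: "(fin_seq \<times> fin_seq) measure \<Rightarrow> fin_seq set \<Rightarrow> real" where
  "expected_shadow_vertices \<mu> P =
     (\<integral>f. real (card {p. p extreme_point_of shadow P f}) \<partial>\<mu>)"

end

theory Submission
  imports Defs
begin

text \<open>
  For a generic frame the shadow is the convex hull of points in general position, so its vertices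
  correspond to its counterclockwise oriented edges, and these are images of edges of \<open>P\<close>.
  For a vector \<open>e\<close> let \<open>c\<close> be the projection of \<open>e\<close> to the plane of the frame, turned by a right
  angle. Then \<open>c\<close> is orthogonal to \<open>e\<close>, its norm is the length of the shadow of \<open>e\<close>, and an edge of
  direction \<open>e\<close> is visible in the shadow iff \<open>c\<close> lies in a fixed open cone. The distribution of \<open>c\<close>
  is invariant under rotations fixing \<open>e\<close>, so the norm of \<open>c\<close> is independent of its direction.
  Consequently the expected perimeter of the shadow is \<open>\<kappa>\<close> times the sum over the edges of
  \<open>P\<close> of length times probability of visibility, where \<open>\<kappa>\<close> is the mean length of the shadow of a
  unit vector; it therefore lies between \<open>\<kappa> m s\<close> and \<open>\<kappa> M s\<close>. On the other hand the perimeter of a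
  shadow is at least twice the shadow of any segment between two points of \<open>P\<close>, of mean \<open>2 \<kappa>\<close> times
  the length of the segment, and it is at most four times the diameter of \<open>P\<close>. Second and fourth
  moments of a coordinate of the frame show that \<open>\<kappa>\<close> is at least of order \<open>1 / sqrt n\<close>.
\<close>

section \<open>Oriented edges of a planar convex hull\<close>

text \<open>Twice the signed area of the triangle spanned by the images of \<open>a\<close>,
  \<open>b\<close>, \<open>x\<close> in the plane with coordinates \<open>f\<close> and
  \<open>h\<close>. Coordinates are functions on the points, so turning the plane only changes the
  pair of functions.\<close>

definition orient :: "('a \<Rightarrow> real) \<Rightarrow> ('a \<Rightarrow> real) \<Rightarrow> 'a \<Rightarrow> 'a \<Rightarrow> 'a \<Rightarrow> real" where
  "orient f h a b x = (f b - f a) * (h x - h a) - (h b - h a) * (f x - f a)"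

definition general_position :: "('a \<Rightarrow> real) \<Rightarrow> ('a \<Rightarrow> real) \<Rightarrow> 'a set \<Rightarrow> bool" where
  "general_position f h S \<longleftrightarrow>
     (\<forall>a\<in>S. \<forall>b\<in>S. \<forall>x\<in>S. a \<noteq> b \<longrightarrow> x \<noteq> a \<longrightarrow> x \<noteq> b \<longrightarrow> orient f h a b x \<noteq> 0)"

text \<open>Counterclockwise orientation: all other points lie strictly to the left. A set of two
  points has both orientations as edges, so a segment counts as a polygon with two sides, matching
  its two vertices and the doubled widths below.\<close>

definition hull_edges :: "('a \<Rightarrow> real) \<Rightarrow> ('a \<Rightarrow> real) \<Rightarrow> 'a set \<Rightarrow> ('a \<times> 'a) set" where
  "hull_edges f h S =
     {(a, b). a \<in> S \<and> b \<in> S \<and> a \<noteq> b \<and> (\<forall>x\<in>S - {a, b}. 0 < orient f h a b x)}"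

lemma finite_hull_edges: "finite S \<Longrightarrow> finite (hull_edges f h S)"
  by (rule finite_subset[of _ "S \<times> S"]) (auto simp: hull_edges_def)

lemma orient_rotate:
  "orient (\<lambda>x. p * f x + q * h x) (\<lambda>x. p * h x - q * f x) a b x = (p\<^sup>2 + q\<^sup>2) * orient f h a b x"
  by (simp add: orient_def algebra_simps power2_eq_square)

lemma
  assumes "p\<^sup>2 + q\<^sup>2 > 0"
  shows general_position_rotate:
      "general_position (\<lambda>x. p * f x + q * h x) (\<lambda>x. p * h x - q * f x) S
         \<longleftrightarrow> general_position f h S"
    and hull_edges_rotate:
      "hull_edges (\<lambda>x. p * f x + q * h x) (\<lambda>x. p * h x - q * f x) S = hull_edges f h S"
  using assms unfolding general_position_def hull_edges_def orient_rotate
  by (auto simp: zero_less_mult_iff)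

text \<open>Ascending edges form the lower boundary of the hull, which meets a vertical line only
  once. The quotients in \<open>aux\<close> are the heights at which two edges cross the line at
  \<open>t\<close>.\<close>

lemma ascending_hull_edge_unique:
  assumes ab: "(a, b) \<in> hull_edges f h S" and cd: "(c, d) \<in> hull_edges f h S"
    and t: "f a < t" "t < f b" "f c < t" "t < f d"
  shows "(a, b) = (c, d)"
proof -
  have aux: "{c', d'} \<subseteq> {a', b'} \<or>
      (h a' * (f b' - t) + h b' * (t - f a')) / (f b' - f a')
        < (h c' * (f d' - t) + h d' * (t - f c')) / (f d' - f c')"
    and aux2: "(h a' * (f b' - t) + h b' * (t - f a')) / (f b' - f a')
        \<le> (h c' * (f d' - t) + h d' * (t - f c')) / (f d' - f c')"
    if e: "(a', b') \<in> hull_edges f h S" "(c', d') \<in> hull_edges f h S"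
      and t': "f a' < t" "t < f b'" "f c' < t" "t < f d'" for a' b' c' d'
  proof -
    have pos: "0 \<le> orient f h a' b' x" "x \<notin> {a', b'} \<Longrightarrow> 0 < orient f h a' b' x" if "x \<in> S" for x
      using e(1) that unfolding hull_edges_def
      by (cases "x = a' \<or> x = b'"; force simp: orient_def)+
    have cdS: "c' \<in> S" "d' \<in> S" using e(2) by (auto simp: hull_edges_def)
    \<comment> \<open>The crossing point of \<open>(c', d')\<close> is a weighted mean of its
      endpoints, so its height above the line through \<open>a'\<close> and \<open>b'\<close> is the
      same mean of the two orientations, divided by \<open>f b' - f a'\<close>.\<close>
    have eq: "(h c' * (f d' - t) + h d' * (t - f c')) / (f d' - f c')
        - (h a' * (f b' - t) + h b' * (t - f a')) / (f b' - f a')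
       = (orient f h a' b' c' * (f d' - t) + orient f h a' b' d' * (t - f c'))
          / ((f b' - f a') * (f d' - f c'))"
      using t' by (simp add: orient_def field_simps)
    have den: "0 < (f b' - f a') * (f d' - f c')" using t' by simp
    have "0 \<le> orient f h a' b' c' * (f d' - t) + orient f h a' b' d' * (t - f c')"
      using pos(1)[OF cdS(1)] pos(1)[OF cdS(2)] t' by simp
    then show "(h a' * (f b' - t) + h b' * (t - f a')) / (f b' - f a')
        \<le> (h c' * (f d' - t) + h d' * (t - f c')) / (f d' - f c')"
      using eq den by (smt (verit) divide_nonneg_pos)
    have "0 < orient f h a' b' c' * (f d' - t) + orient f h a' b' d' * (t - f c')"
      if ncd: "\<not> {c', d'} \<subseteq> {a', b'}"
    proof -
      have nn: "0 \<le> orient f h a' b' c' * (f d' - t)" "0 \<le> orient f h a' b' d' * (t - f c')"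
        using pos(1)[OF cdS(1)] pos(1)[OF cdS(2)] t' by auto
      consider "c' \<notin> {a', b'}" | "d' \<notin> {a', b'}" using ncd by blast
      then show ?thesis
      proof cases
        case 1
        then have "0 < orient f h a' b' c' * (f d' - t)" using pos(2)[OF cdS(1)] t' by simp
        then show ?thesis using nn by simp
      next
        case 2
        then have "0 < orient f h a' b' d' * (t - f c')" using pos(2)[OF cdS(2)] t' by simp
        then show ?thesis using nn by simp
      qed
    qed
    then show "{c', d'} \<subseteq> {a', b'} \<or>
      (h a' * (f b' - t) + h b' * (t - f a')) / (f b' - f a')
        < (h c' * (f d' - t) + h d' * (t - f c')) / (f d' - f c')"
      using eq den by (smt (verit) divide_pos_pos)
  qed
  \<comment> \<open>A strict inequality from \<open>aux\<close> would contradict \<open>aux2\<close>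
    with the two edges exchanged.\<close>
  have "{c, d} \<subseteq> {a, b}"
    using aux[OF ab cd t] aux2[OF cd ab t(3,4,1,2)] by linarith
  then show ?thesis using t by auto
qed

text \<open>Among the pairs straddling \<open>t\<close>, one that crosses the vertical line at
  \<open>t\<close> lowest is a lower edge: a point to the right of it could replace the endpoint on
  its own side of \<open>t\<close> and lower the crossing. Since no point lies over
  \<open>t\<close>, each point has such a side.\<close>

lemma ascending_hull_edge_exists:
  assumes fin: "finite S" and gp: "general_position f h S"
    and pq: "p \<in> S" "q \<in> S" "f p < t" "t < f q" and t: "t \<notin> f ` S"
  shows "\<exists>(a, b)\<in>hull_edges f h S. f a < t \<and> t < f b"
proof -
  define cross where
    "cross a b = (h a * (f b - t) + h b * (t - f a)) / (f b - f a)" for a b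
  let ?C = "{(a, b). a \<in> S \<and> b \<in> S \<and> f a < t \<and> t < f b}"
  have "finite ?C" by (rule finite_subset[of _ "S \<times> S"]) (use fin in auto)
  moreover have "?C \<noteq> {}" using pq by auto
  ultimately obtain z where z: "z \<in> ?C" "\<And>y. y \<in> ?C \<Longrightarrow> case_prod cross z \<le> case_prod cross y"
    by (metis (no_types, lifting) ex_is_arg_min_if_finite is_arg_min_linorder)
  obtain a b where zab: "z = (a, b)" by (cases z)
  have ab: "a \<in> S" "b \<in> S" "f a < t" "t < f b" using z(1) zab by auto
  have min: "cross a b \<le> cross c d" if "c \<in> S" "d \<in> S" "f c < t" "t < f d" for c d
    using z(2)[of "(c, d)"] that zab by auto
  have "0 < orient f h a b x" if x: "x \<in> S - {a, b}" for x
  proof -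
    have ne: "orient f h a b x \<noteq> 0"
      using gp x ab unfolding general_position_def by (metis DiffE insertI1 insertI2 order_less_asym)
    have "f x \<noteq> t" using t x by auto
    then consider "f x < t" | "t < f x" by linarith
    then show ?thesis
    proof cases
      case 1
      have "cross x b - cross a b = orient f h a b x * (f b - t) / ((f b - f a) * (f b - f x))"
        using ab 1 unfolding cross_def orient_def by (simp add: divide_simps) (simp add: algebra_simps)
      then have "0 \<le> orient f h a b x * (f b - t) / ((f b - f a) * (f b - f x))"
        using min[of x b] x ab 1 by auto
      then show ?thesis using ab 1 ne
        by (auto simp: zero_le_divide_iff zero_le_mult_iff mult_le_0_iff not_less)
    next
      case 2
      have "cross a x - cross a b = orient f h a b x * (t - f a) / ((f b - f a) * (f x - f a))"
        using ab 2 unfolding cross_def orient_def by (simp add: divide_simps) (simp add: algebra_simps)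
      then have "0 \<le> orient f h a b x * (t - f a) / ((f b - f a) * (f x - f a))"
        using min[of a x] x ab 2 by auto
      then show ?thesis using ab 2 ne
        by (auto simp: zero_le_divide_iff zero_le_mult_iff mult_le_0_iff not_less)
    qed
  qed
  then have "(a, b) \<in> hull_edges f h S" using ab by (auto simp: hull_edges_def)
  then show ?thesis using ab by auto
qed

text \<open>The ascending edges project to disjoint open intervals that cover the projection of the
  hull up to finitely many points, so Lebesgue measure adds up their lengths.\<close>

lemma sum_ascending_hull_edges:
  assumes fin: "finite S" and gp: "general_position f h S" and S: "S \<noteq> {}"
  shows "(\<Sum>(a, b)\<in>{(a, b)\<in>hull_edges f h S. f a < f b}. f b - f a) = Max (f ` S) - Min (f ` S)"
proof -
  let ?A = "{(a, b)\<in>hull_edges f h S. f a < f b}"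
  define I where "I = (\<lambda>(a, b). {f a <..< f b})"
  have finA: "finite ?A" by (rule finite_subset[OF _ finite_hull_edges[OF fin]]) auto
  have "disjoint_family_on I ?A"
  proof (unfold disjoint_family_on_def, intro ballI impI)
    fix y z assume "y \<in> ?A" "z \<in> ?A" "y \<noteq> z"
    then show "I y \<inter> I z = {}"
      using ascending_hull_edge_unique[of "fst y" "snd y" f h S "fst z" "snd z"]
      by (fastforce simp: I_def)
  qed
  moreover have "I ` ?A \<subseteq> sets lborel" by (auto simp: I_def)
  moreover have "\<And>z. z \<in> ?A \<Longrightarrow> emeasure lborel (I z) \<noteq> \<infinity>" by (auto simp: I_def)
  ultimately have meas: "measure lborel (\<Union>z\<in>?A. I z) = (\<Sum>z\<in>?A. measure lborel (I z))"
    using finA by (intro measure_finite_Union) auto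
  have "(\<Sum>z\<in>?A. measure lborel (I z)) = (\<Sum>(a, b)\<in>?A. f b - f a)"
    by (rule sum.cong) (auto simp: I_def)
  moreover have "measure lborel (\<Union>z\<in>?A. I z) = Max (f ` S) - Min (f ` S)"
  proof (rule antisym)
    have "(\<Union>z\<in>?A. I z) \<subseteq> {Min (f ` S)..Max (f ` S)}"
    proof
      fix t assume "t \<in> (\<Union>z\<in>?A. I z)"
      then obtain a b where ab: "a \<in> S" "b \<in> S" "f a < t" "t < f b"
        by (auto simp: I_def hull_edges_def)
      have "Min (f ` S) \<le> f a" "f b \<le> Max (f ` S)" using ab fin by auto
      then show "t \<in> {Min (f ` S)..Max (f ` S)}" using ab by auto
    qed
    then have "measure lborel (\<Union>z\<in>?A. I z) \<le> measure lborel {Min (f ` S)..Max (f ` S)}"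
      using finA by (intro measure_mono_fmeasurable) (auto simp: I_def fmeasurable_def emeasure_lborel_Icc_eq intro!: sets.finite_UN)
    also have "\<dots> = Max (f ` S) - Min (f ` S)"
      using fin S by (simp add: Min_le_iff)
    finally show "measure lborel (\<Union>z\<in>?A. I z) \<le> Max (f ` S) - Min (f ` S)" .
  next
    have fS: "finite (f ` S)" "f ` S \<noteq> {}" using fin S by auto
    have sub: "{Min (f ` S)<..<Max (f ` S)} \<subseteq> (\<Union>z\<in>?A. I z) \<union> f ` S"
    proof
      fix t assume t: "t \<in> {Min (f ` S)<..<Max (f ` S)}"
      obtain p q where pq: "p \<in> S" "f p = Min (f ` S)" "q \<in> S" "f q = Max (f ` S)"
        using Min_in[OF fS] Max_in[OF fS] by (metis imageE)
      show "t \<in> (\<Union>z\<in>?A. I z) \<union> f ` S"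
      proof (cases "t \<in> f ` S")
        case False
        then obtain a b where "(a, b) \<in> hull_edges f h S" "f a < t" "t < f b"
          using ascending_hull_edge_exists[OF fin gp pq(1,3), of t] t pq by auto
        then have "(a, b) \<in> ?A" "t \<in> I (a, b)" by (auto simp: I_def)
        then show ?thesis by blast
      qed simp
    qed
    have bd: "(\<Union>z\<in>?A. I z) \<in> fmeasurable lborel"
      using finA by (intro fmeasurable.finite_UN) (auto simp: I_def fmeasurable_def)
    have nul: "f ` S \<in> null_sets lborel" using fS by (simp add: finite_imp_null_set_lborel)
    have "Max (f ` S) - Min (f ` S) = measure lborel {Min (f ` S)<..<Max (f ` S)}"
      using fS by (subst measure_lborel_Ioo) (auto intro: order_trans[OF Min_le Max_ge] simp: ex_in_conv[symmetric])
    also have "\<dots> \<le> measure lborel ((\<Union>z\<in>?A. I z) \<union> f ` S)"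
      by (rule measure_mono_fmeasurable[OF sub]) (use bd nul in \<open>auto intro: fmeasurable.Un simp: fmeasurableI_null_sets\<close>)
    also have "\<dots> = measure lborel (\<Union>z\<in>?A. I z)"
      using bd nul by (intro measure_Un_null_set) auto
    finally show "Max (f ` S) - Min (f ` S) \<le> measure lborel (\<Union>z\<in>?A. I z)" .
  qed
  ultimately show ?thesis using meas by simp
qed

text \<open>A half turn preserves \<open>hull_edges\<close> and exchanges ascending with descending
  edges; edges with equal first coordinates contribute nothing.\<close>

lemma sum_abs_hull_edges:
  assumes fin: "finite S" and gp: "general_position f h S" and S: "S \<noteq> {}"
  shows "(\<Sum>(a, b)\<in>hull_edges f h S. \<bar>f b - f a\<bar>) = 2 * (Max (f ` S) - Min (f ` S))"
proof -
  let ?E = "hull_edges f h S"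
  have finE: "finite ?E" by (rule finite_hull_edges[OF fin])
  have neg: "hull_edges (\<lambda>x. - f x) (\<lambda>x. - h x) S = ?E"
    "general_position (\<lambda>x. - f x) (\<lambda>x. - h x) S"
    using hull_edges_rotate[of "-1" 0 f h S] general_position_rotate[of "-1" 0 f h S] gp by simp_all
  have fS: "finite (f ` S)" "f ` S \<noteq> {}" using fin S by auto
  have im: "(\<lambda>x. - f x) ` S = uminus ` f ` S" by auto
  have "Max (uminus ` f ` S) = - Min (f ` S)" "Min (uminus ` f ` S) = - Max (f ` S)"
    using fS by (auto intro!: Max_eqI Min_eqI)
  then have down: "(\<Sum>(a, b)\<in>{(a, b)\<in>?E. f b < f a}. f a - f b) = Max (f ` S) - Min (f ` S)"
    using sum_ascending_hull_edges[OF fin neg(2) S] unfolding neg(1) im by (simp add: case_prod_unfold)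
  have "(\<Sum>(a, b)\<in>?E. \<bar>f b - f a\<bar>)
      = (\<Sum>(a, b)\<in>?E. (if f a < f b then f b - f a else 0)) + (\<Sum>(a, b)\<in>?E. (if f b < f a then f a - f b else 0))"
    unfolding sum.distrib[symmetric] by (rule sum.cong) auto
  also have "(\<Sum>(a, b)\<in>?E. (if f a < f b then f b - f a else 0)) = (\<Sum>(a, b)\<in>{(a, b)\<in>?E. f a < f b}. f b - f a)"
    by (rule sum.mono_neutral_cong_right) (use finE in \<open>auto split: if_splits\<close>)
  also have "(\<Sum>(a, b)\<in>?E. (if f b < f a then f a - f b else 0)) = (\<Sum>(a, b)\<in>{(a, b)\<in>?E. f b < f a}. f a - f b)"
    by (rule sum.mono_neutral_cong_right) (use finE in \<open>auto split: if_splits\<close>)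
  finally show ?thesis using down sum_ascending_hull_edges[OF fin gp S] by simp
qed

text \<open>In coordinates turned so that the first axis points from \<open>y\<close> to
  \<open>x\<close>, the width is at least the distance of the two images, and every edge is at least
  as long as its projection to that axis.\<close>

lemma perimeter_ge:
  assumes fin: "finite S" and gp: "general_position f h S" and xy: "x \<in> S" "y \<in> S"
  shows "2 * sqrt ((f x - f y)\<^sup>2 + (h x - h y)\<^sup>2)
           \<le> (\<Sum>(a, b)\<in>hull_edges f h S. sqrt ((f b - f a)\<^sup>2 + (h b - h a)\<^sup>2))"
proof (cases "f x = f y \<and> h x = h y")
  case True
  then show ?thesis by (auto intro!: sum_nonneg)
next
  case False
  define r where "r = sqrt ((f x - f y)\<^sup>2 + (h x - h y)\<^sup>2)"
  define p where "p = (f x - f y) / r"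
  define q where "q = (h x - h y) / r"
  have r: "r > 0" "r\<^sup>2 = (f x - f y)\<^sup>2 + (h x - h y)\<^sup>2"
    using False by (auto simp: r_def sum_power2_gt_zero_iff)
  have pq: "p\<^sup>2 + q\<^sup>2 = 1"
    using r by (simp add: p_def q_def power_divide add_divide_distrib[symmetric] del: sum_power2_eq_zero_iff) (metis False r(2) sum_power2_eq_zero_iff right_minus_eq)
  let ?f = "\<lambda>x. p * f x + q * h x" and ?h = "\<lambda>x. p * h x - q * f x"
  have "r = ?f x - ?f y"
  proof -
    have "?f x - ?f y = p * (f x - f y) + q * (h x - h y)" by (simp add: algebra_simps)
    also have "\<dots> = r\<^sup>2 / r" unfolding r(2)
      by (simp add: p_def q_def power2_eq_square add_divide_distrib)
    finally show ?thesis using r(1) by (simp add: power2_eq_square)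
  qed
  also have "\<dots> \<le> Max (?f ` S) - Min (?f ` S)"
    using xy fin by (intro diff_mono Max_ge Min_le) auto
  finally have "2 * r \<le> (\<Sum>(a, b)\<in>hull_edges ?f ?h S. \<bar>?f b - ?f a\<bar>)"
    by (subst sum_abs_hull_edges) (use fin gp xy pq in \<open>auto simp: general_position_rotate\<close>)
  also have "hull_edges ?f ?h S = hull_edges f h S"
    by (rule hull_edges_rotate) (simp add: pq)
  also have "(\<Sum>(a, b)\<in>hull_edges f h S. \<bar>?f b - ?f a\<bar>)
      \<le> (\<Sum>(a, b)\<in>hull_edges f h S. sqrt ((f b - f a)\<^sup>2 + (h b - h a)\<^sup>2))"
  proof (intro sum_mono, clarify)
    fix a b
    have "(?f b - ?f a)\<^sup>2 + (?h b - ?h a)\<^sup>2 = (p\<^sup>2 + q\<^sup>2) * ((f b - f a)\<^sup>2 + (h b - h a)\<^sup>2)"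
      by (simp add: algebra_simps power2_eq_square)
    then have "(?f b - ?f a)\<^sup>2 \<le> (f b - f a)\<^sup>2 + (h b - h a)\<^sup>2"
      unfolding pq by (smt (verit) mult_1 zero_le_power2)
    then show "\<bar>?f b - ?f a\<bar> \<le> sqrt ((f b - f a)\<^sup>2 + (h b - h a)\<^sup>2)"
      by (metis real_sqrt_abs real_sqrt_le_iff)
  qed
  finally show ?thesis by (simp add: r_def)
qed

text \<open>The perimeter is at most that of the bounding box; a quarter turn transfers the width
  formula to the second coordinate.\<close>

lemma perimeter_le:
  assumes fin: "finite S" and gp: "general_position f h S" and S: "S \<noteq> {}"
    and f: "\<And>x y. x \<in> S \<Longrightarrow> y \<in> S \<Longrightarrow> f x - f y \<le> d"
    and h: "\<And>x y. x \<in> S \<Longrightarrow> y \<in> S \<Longrightarrow> h x - h y \<le> d"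
  shows "(\<Sum>(a, b)\<in>hull_edges f h S. sqrt ((f b - f a)\<^sup>2 + (h b - h a)\<^sup>2)) \<le> 4 * d"
proof -
  have width: "Max (g ` S) - Min (g ` S) \<le> d" if "\<And>x y. x \<in> S \<Longrightarrow> y \<in> S \<Longrightarrow> g x - g y \<le> d" for g :: "'a \<Rightarrow> real"
  proof -
    have gS: "finite (g ` S)" "g ` S \<noteq> {}" using fin S by auto
    obtain x y where "x \<in> S" "Max (g ` S) = g x" "y \<in> S" "Min (g ` S) = g y"
      using Min_in[OF gS] Max_in[OF gS] by (metis imageE)
    then show ?thesis using that by simp
  qed
  have rot: "hull_edges h (\<lambda>x. - f x) S = hull_edges f h S" "general_position h (\<lambda>x. - f x) S"
    using hull_edges_rotate[of 0 1 f h S] general_position_rotate[of 0 1 f h S] gp by simp_all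
  have "(\<Sum>(a, b)\<in>hull_edges f h S. sqrt ((f b - f a)\<^sup>2 + (h b - h a)\<^sup>2))
     \<le> (\<Sum>(a, b)\<in>hull_edges f h S. \<bar>f b - f a\<bar> + \<bar>h b - h a\<bar>)"
    by (intro sum_mono) (auto intro: sqrt_sum_squares_le_sum_abs)
  also have "\<dots> = (\<Sum>(a, b)\<in>hull_edges f h S. \<bar>f b - f a\<bar>) + (\<Sum>(a, b)\<in>hull_edges f h S. \<bar>h b - h a\<bar>)"
    by (simp add: sum.distrib case_prod_unfold)
  also have "\<dots> = 2 * (Max (f ` S) - Min (f ` S)) + 2 * (Max (h ` S) - Min (h ` S))"
    using sum_abs_hull_edges[OF fin gp S] sum_abs_hull_edges[OF fin rot(2) S] unfolding rot(1) by simp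
  also have "\<dots> \<le> 2 * d + 2 * d"
    using width[of f] width[of h] f h by simp
  finally show ?thesis by simp
qed

text \<open>A generator is extreme iff it lies outside the hull of the others. That hull is compact,
  so a linear functional \<open>w\<close> then separates strictly.\<close>

lemma extreme_point_of_convex_hull_finite_iff:
  fixes T :: "'a::euclidean_space set"
  assumes "finite T"
  shows "p extreme_point_of (convex hull T) \<longleftrightarrow> p \<in> T \<and> (\<exists>w. \<forall>q\<in>T - {p}. 0 < inner w (q - p))"
proof
  assume p: "p extreme_point_of (convex hull T)"
  then have pT: "p \<in> T" by (rule extreme_point_of_convex_hull)
  have "convex (convex hull T - {p})"
    using p by (simp add: extreme_point_of_stillconvex)
  then have "convex hull (T - {p}) \<subseteq> convex hull T - {p}"
    by (intro hull_minimal) (auto simp: hull_inc)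
  then have "p \<notin> convex hull (T - {p})" by blast
  then obtain w b where "inner w p < b" "\<forall>x\<in>convex hull (T - {p}). inner w x > b"
    using separating_hyperplane_closed_point[of "convex hull (T - {p})" p] assms
      compact_imp_closed[OF finite_imp_compact_convex_hull[of "T - {p}"]] by auto
  then have "\<forall>q\<in>T - {p}. 0 < inner w (q - p)"
    by (smt (verit) hull_inc inner_diff_right)
  then show "p \<in> T \<and> (\<exists>w. \<forall>q\<in>T - {p}. 0 < inner w (q - p))" using pT by blast
next
  assume "p \<in> T \<and> (\<exists>w. \<forall>q\<in>T - {p}. 0 < inner w (q - p))"
  then obtain w where pT: "p \<in> T" and w: "\<forall>q\<in>T - {p}. 0 < inner w (q - p)" by blast
  have "convex hull (T - {p}) \<subseteq> {z. inner w z > inner w p}"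
    by (intro hull_minimal convex_halfspace_gt) (use w in \<open>auto simp: inner_diff_right\<close>)
  then have "p \<notin> convex hull (T - {p})" by auto
  then show "p extreme_point_of (convex hull T)"
    using extreme_point_of_convex_hull_insert[of "T - {p}" p] assms pT by (simp add: insert_absorb)
qed

text \<open>Each vertex is the starting point of exactly one counterclockwise edge. Two distinct
  points are assumed because a single point is a vertex without edges.\<close>

lemma card_extreme_points_eq_card_hull_edges:
  fixes f h :: "'a \<Rightarrow> real"
  assumes fin: "finite S" and gp: "general_position f h S" and inj: "inj_on (\<lambda>x. (f x, h x)) S"
    and S2: "p0 \<in> S" "q0 \<in> S" "p0 \<noteq> q0"
  shows "card {p. p extreme_point_of (convex hull ((\<lambda>x. (f x, h x)) ` S))} = card (hull_edges f h S)"
proof -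
  let ?\<pi> = "\<lambda>x. (f x, h x)"
  have ext: "?\<pi> a extreme_point_of (convex hull (?\<pi> ` S)) \<longleftrightarrow>
      (\<exists>p q. \<forall>x\<in>S - {a}. 0 < p * (f x - f a) + q * (h x - h a))" if "a \<in> S" for a
  proof -
    have "?\<pi> ` S - {?\<pi> a} = ?\<pi> ` (S - {a})"
      using inj that by (auto simp: inj_on_def)
    then show ?thesis
      using fin that by (simp add: extreme_point_of_convex_hull_finite_iff inner_prod_def)
  qed
  have "inj_on (?\<pi> \<circ> fst) (hull_edges f h S)"
  proof (rule inj_onI, clarsimp)
    fix a b c d assume ab: "(a, b) \<in> hull_edges f h S" and cd: "(c, d) \<in> hull_edges f h S"
      and "f a = f c" "h a = h c"
    then have ac: "a = c" using inj by (auto simp: inj_on_def hull_edges_def)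
    \<comment> \<open>If two edges left \<open>a\<close>, each of \<open>b\<close> and
      \<open>d\<close> would lie strictly to the left of the line towards the other.\<close>
    have "b = d"
    proof (rule ccontr)
      assume "b \<noteq> d"
      then have "0 < orient f h a b d" "0 < orient f h a d b"
        using ab cd ac by (auto simp: hull_edges_def)
      then show False by (simp add: orient_def algebra_simps)
    qed
    then show "a = c \<and> b = d" using ac by simp
  qed
  moreover have "(?\<pi> \<circ> fst) ` hull_edges f h S = {p. p extreme_point_of (convex hull (?\<pi> ` S))}"
  proof (intro subset_antisym subsetI)
    fix z assume "z \<in> (?\<pi> \<circ> fst) ` hull_edges f h S"
    then obtain a b where ab: "(a, b) \<in> hull_edges f h S" and z: "z = ?\<pi> a" by auto
    have abS: "a \<in> S" "b \<in> S" "a \<noteq> b" using ab by (auto simp: hull_edges_def)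
    \<comment> \<open>The functional normal to the edge takes equal values at \<open>a\<close> and
      \<open>b\<close>. Tilting it along the edge, by adding \<open>\<epsilon> * g\<close>, makes it
      positive at \<open>b\<close>; for small \<open>\<epsilon>\<close> it stays positive at the
      finitely many other points.\<close>
    define g where "g x = (f b - f a) * (f x - f a) + (h b - h a) * (h x - h a)" for x
    have "\<exists>\<epsilon>>0. \<forall>x\<in>S - {a}. 0 < orient f h a b x + \<epsilon> * g x"
    proof -
      have "\<forall>x\<in>S - {a}. \<forall>\<^sub>F \<epsilon> in at_right 0. 0 < orient f h a b x + \<epsilon> * g x"
      proof
        fix x assume x: "x \<in> S - {a}"
        show "\<forall>\<^sub>F \<epsilon> in at_right 0. 0 < orient f h a b x + \<epsilon> * g x"
        proof (cases "x = b")
          case True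
          have "?\<pi> a \<noteq> ?\<pi> b" using inj abS by (auto simp: inj_on_def)
          then have "0 < g b" unfolding g_def
            by (auto simp: sum_squares_gt_zero_iff)
          then show ?thesis using True eventually_at_right_less[of 0]
            by (auto simp: orient_def elim!: eventually_mono)
        next
          case False
          then have "0 < orient f h a b x" using ab x by (auto simp: hull_edges_def)
          moreover have "((\<lambda>\<epsilon>. orient f h a b x + \<epsilon> * g x) \<longlongrightarrow> orient f h a b x + 0 * g x) (at_right 0)"
            by (intro tendsto_intros)
          ultimately show ?thesis by (auto dest: order_tendstoD(1))
        qed
      qed
      then have "\<forall>\<^sub>F \<epsilon> in at_right 0. \<forall>x\<in>S - {a}. 0 < orient f h a b x + \<epsilon> * g x"
        using fin by (simp add: eventually_ball_finite)
      then have "\<forall>\<^sub>F \<epsilon> in at_right 0. 0 < \<epsilon> \<and> (\<forall>x\<in>S - {a}. 0 < orient f h a b x + \<epsilon> * g x)"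
        using eventually_at_right_less[of 0] by (auto elim: eventually_elim2)
      then show ?thesis by (auto dest!: eventually_happens)
    qed
    then obtain \<epsilon> where "\<forall>x\<in>S - {a}. 0 < orient f h a b x + \<epsilon> * g x" by blast
    then have "\<forall>x\<in>S - {a}. 0 < (\<epsilon> * (f b - f a) - (h b - h a)) * (f x - f a)
        + (\<epsilon> * (h b - h a) + (f b - f a)) * (h x - h a)"
      by (simp add: orient_def g_def algebra_simps)
    then show "z \<in> {p. p extreme_point_of (convex hull (?\<pi> ` S))}"
      unfolding z mem_Collect_eq ext[OF abS(1)] by blast
  next
    fix z assume "z \<in> {p. p extreme_point_of (convex hull (?\<pi> ` S))}"
    then have z: "z extreme_point_of (convex hull (?\<pi> ` S))" by simp
    then obtain a where a: "a \<in> S" "z = ?\<pi> a"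
      using extreme_point_of_convex_hull by blast
    obtain p q where pq: "\<And>x. x \<in> S - {a} \<Longrightarrow> 0 < p * (f x - f a) + q * (h x - h a)"
      using z ext[OF a(1)] a(2) by auto
    have "S - {a} \<noteq> {}" using S2 by auto
    have pq0: "p\<^sup>2 + q\<^sup>2 > 0"
    proof (rule ccontr)
      assume "\<not> ?thesis"
      then have "p = 0" "q = 0" by (auto simp: sum_power2_gt_zero_iff)
      then show False using pq \<open>S - {a} \<noteq> {}\<close> by auto
    qed
    let ?f = "\<lambda>x. p * f x + q * h x" and ?h = "\<lambda>x. p * h x - q * f x"
    have fpos: "?f x - ?f a > 0" if "x \<in> S - {a}" for x
      using pq[OF that] by (simp add: algebra_simps)
    \<comment> \<open>With the supporting functional as first coordinate, all other points lie to
      the right of \<open>a\<close>; the one seen from \<open>a\<close> under the least slope is the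
      next vertex counterclockwise.\<close>
    define sl where "sl x = (?h x - ?h a) / (?f x - ?f a)" for x
    obtain b where b: "b \<in> S - {a}" "\<And>x. x \<in> S - {a} \<Longrightarrow> sl b \<le> sl x"
      using ex_is_arg_min_if_finite[of "S - {a}" sl] fin \<open>S - {a} \<noteq> {}\<close>
      by (auto simp: is_arg_min_linorder)
    have "0 < orient f h a b x" if x: "x \<in> S - {a, b}" for x
    proof -
      have "sl b \<le> sl x" using b x by auto
      then have "0 \<le> orient ?f ?h a b x"
        using fpos[of x] fpos[of b] b x unfolding sl_def orient_def
        by (simp add: divide_simps mult.commute split: if_splits)
      moreover have "orient f h a b x \<noteq> 0"
        using gp x b a unfolding general_position_def by (metis DiffE insertI1 insertI2)
      ultimately show ?thesis
        using pq0 unfolding orient_rotate by (simp add: zero_le_mult_iff)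
    qed
    then have "(a, b) \<in> hull_edges f h S" using a b by (auto simp: hull_edges_def)
    then show "z \<in> (?\<pi> \<circ> fst) ` hull_edges f h S" using a by force
  qed
  ultimately show ?thesis by (metis card_image)
qed

section \<open>Polytopes\<close>

text \<open>A generating set of least cardinality is irredundant.\<close>

lemma polytope_irredundant_hull:
  assumes "polytope P"
  obtains S where "finite S" "P = convex hull S" "\<And>a. a \<in> S \<Longrightarrow> a \<notin> convex hull (S - {a})"
proof -
  define Q where "Q S \<longleftrightarrow> finite S \<and> P = convex hull S" for S
  have "\<exists>S. Q S" using assms by (auto simp: polytope_def Q_def)
  then obtain S where S: "Q S" "\<And>T. Q T \<Longrightarrow> card S \<le> card T"
    using ex_has_least_nat[of Q _ card] by blast
  show ?thesis
  proof (rule that)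
    fix a assume a: "a \<in> S"
    show "a \<notin> convex hull (S - {a})"
    proof
      assume "a \<in> convex hull (S - {a})"
      then have "convex hull S = convex hull (S - {a})"
        using hull_redundant[of a convex "S - {a}"] a by (simp add: insert_absorb)
      then have "Q (S - {a})" using S(1) by (auto simp: Q_def)
      then have "card S \<le> card (S - {a})" by (rule S(2))
      then show False using a S(1) by (metis Q_def card_Diff1_less linorder_not_less)
    qed
  qed (use S in \<open>auto simp: Q_def\<close>)
qed

text \<open>Of three distinct collinear points one lies between the other two; the position of
  \<open>r\<close> relative to 0 and 1 tells which.\<close>

lemma irredundant_not_collinear:
  fixes S :: "'a::real_vector set"
  assumes irr: "\<And>a. a \<in> S \<Longrightarrow> a \<notin> convex hull (S - {a})"
    and S: "a \<in> S" "b \<in> S" "x \<in> S" "a \<noteq> b" "x \<noteq> a" "x \<noteq> b"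
  shows "x - a \<noteq> r *\<^sub>R (b - a)"
proof
  assume eq: "x - a = r *\<^sub>R (b - a)"
  have no: "p \<noteq> (1 - u) *\<^sub>R q + u *\<^sub>R w"
    if "p \<in> S" "q \<in> S" "w \<in> S" "p \<noteq> q" "p \<noteq> w" "0 \<le> u" "u \<le> 1" for p q w and u :: real
  proof
    assume p: "p = (1 - u) *\<^sub>R q + u *\<^sub>R w"
    have "convex (convex hull (S - {p}))" "q \<in> convex hull (S - {p})" "w \<in> convex hull (S - {p})"
      using that by (auto simp: hull_inc)
    then have "p \<in> convex hull (S - {p})"
      using p that(6,7) convexD_alt by metis
    then show False using irr that(1) by blast
  qed
  have x: "x = (1 - r) *\<^sub>R a + r *\<^sub>R b" using eq by (simp add: algebra_simps)
  consider "0 \<le> r \<and> r \<le> 1" | "r > 1" | "r < 0" by linarith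
  then show False
  proof cases
    case 1
    then show False using no[OF S(3,1,2,5,6), of r] x by simp
  next
    case 2
    have "(1 / r) *\<^sub>R (x - a) = b - a" unfolding eq using 2 by simp
    then have "b = (1 - 1 / r) *\<^sub>R a + (1 / r) *\<^sub>R x" by (simp add: algebra_simps)
    then show False using no[OF S(2,1,3), of "1 / r"] S 2 by auto
  next
    case 3
    have "(1 / (1 - r)) *\<^sub>R (x - r *\<^sub>R b) = (1 / (1 - r)) *\<^sub>R ((1 - r) *\<^sub>R a)"
      by (simp add: x)
    also have "\<dots> = a" using 3 by simp
    finally have "a = (1 / (1 - r)) *\<^sub>R x + (- r / (1 - r)) *\<^sub>R b"
      by (simp add: scaleR_diff_right)
    moreover have "1 / (1 - r) = 1 - - r / (1 - r)" using 3 by (simp add: field_simps)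
    ultimately have "a = (1 - - r / (1 - r)) *\<^sub>R x + (- r / (1 - r)) *\<^sub>R b" by simp
    moreover have "0 \<le> - r / (1 - r)" "- r / (1 - r) \<le> 1" using 3 by (simp_all add: field_simps)
    ultimately show False using no[OF S(1,3,2), of "- r / (1 - r)"] S by metis
  qed
qed

section \<open>Diameters, faces and edge lengths of convex hulls\<close>

lemma dist_convex_hull_le:
  fixes T :: "'a::real_normed_vector set"
  assumes T: "\<And>x y. x \<in> T \<Longrightarrow> y \<in> T \<Longrightarrow> dist x y \<le> d"
    and xy: "x \<in> convex hull T" "y \<in> convex hull T"
  shows "dist x y \<le> d"
proof -
  have "convex hull T \<subseteq> cball z d" if "z \<in> T" for z
    using T that by (intro hull_minimal) auto
  then have "dist z x \<le> d" if "z \<in> T" for z using xy(1) that by (meson mem_cball subsetD)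
  \<comment> \<open>Balls are convex, so the bound passes to the hull one argument at a time; now
    \<open>x\<close> is the centre.\<close>
  then have "convex hull T \<subseteq> cball x d"
    by (intro hull_minimal) (auto simp: dist_commute)
  then show ?thesis using xy(2) by auto
qed

lemma diameter_convex_hull_le:
  fixes T :: "'a::real_normed_vector set"
  assumes "\<And>x y. x \<in> T \<Longrightarrow> y \<in> T \<Longrightarrow> dist x y \<le> d" and "T \<noteq> {}"
  shows "diameter (convex hull T) \<le> d"
  using dist_convex_hull_le[of T d] assms by (intro diameter_le) (auto simp: dist_norm)

lemma diameter_closed_segment:
  fixes a b :: "'a::real_normed_vector"
  shows "diameter (closed_segment a b) = dist a b"
proof (rule antisym)
  show "diameter (closed_segment a b) \<le> dist a b"
    unfolding segment_convex_hull by (rule diameter_convex_hull_le) (auto simp: dist_commute)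
  show "dist a b \<le> diameter (closed_segment a b)"
    by (rule diameter_bounded_bound) (auto simp: segment_convex_hull finite_imp_bounded_convex_hull hull_inc)
qed

text \<open>The induction runs over subsets \<open>S'\<close> of \<open>S\<close>, but the face
  property is always used in the hull of all of \<open>S\<close>: a point of \<open>T\<close> inside
  a segment from the new generator \<open>a\<close> to a point \<open>b\<close> of the old hull
  forces both ends into \<open>T\<close>.\<close>

lemma face_of_convex_hull_finite:
  fixes S :: "'a::real_vector set"
  assumes "finite S" and T: "T face_of (convex hull S)"
  shows "T = convex hull (S \<inter> T)"
proof
  have "convex hull S' \<inter> T \<subseteq> convex hull (S' \<inter> T)" if "S' \<subseteq> S" for S'
    using finite_subset[OF that assms(1)] that
  proof (induction S' rule: finite_induct)
    case (insert a S')
    have IH: "convex hull S' \<inter> T \<subseteq> convex hull (S' \<inter> T)" using insert by blast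
    have mono: "convex hull (S' \<inter> T) \<subseteq> convex hull (insert a S' \<inter> T)" by (rule hull_mono) auto
    show ?case
    proof (cases "S' = {}")
      case False
      show ?thesis
      proof
        fix x assume x: "x \<in> convex hull (insert a S') \<inter> T"
        then obtain u v b where uv: "u \<ge> 0" "v \<ge> 0" "u + v = 1" and b: "b \<in> convex hull S'"
          and xeq: "x = u *\<^sub>R a + v *\<^sub>R b"
          unfolding convex_hull_insert[OF False] by blast
        consider "v = 0" | "x = b" | "x = a" | "0 < v" "v < 1" "a \<noteq> b"
          using uv xeq by (cases "a = b"; cases "v = 0"; cases "u = 0") (auto simp flip: scaleR_add_left)
        then show "x \<in> convex hull (insert a S' \<inter> T)"
        proof cases
          case 1
          then have "x = a" using uv xeq by simp
          then show ?thesis using x by (auto intro: hull_inc)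
        next
          case 2
          then show ?thesis using IH mono b x by blast
        next
          case 3
          then show ?thesis using x by (auto intro: hull_inc)
        next
          case 4
          have "u = 1 - v" using uv by simp
          then have "x \<in> open_segment a b" using 4 xeq by (auto simp: in_segment)
          moreover have "a \<in> convex hull S" "b \<in> convex hull S"
            using insert.prems b hull_mono[of S' S convex] by (auto intro: hull_inc)
          ultimately have ab: "a \<in> T" "b \<in> T" using T x by (auto dest: face_ofD)
          then have "b \<in> convex hull (insert a S' \<inter> T)" "a \<in> convex hull (insert a S' \<inter> T)"
            using IH mono b by (auto intro: hull_inc)
          then show ?thesis unfolding xeq
            using uv by (intro convexD[OF convex_convex_hull]) auto
        qed
      qed
    next
      case True
      then show ?thesis by (auto intro: hull_inc)
    qed
  qed simp
  from this[of S] show "T \<subseteq> convex hull (S \<inter> T)"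
    using face_of_imp_subset[OF T] by blast
  show "convex hull (S \<inter> T) \<subseteq> T"
    by (intro hull_minimal face_of_imp_convex[OF T]) auto
qed

lemma finite_edge_lengths:
  assumes "polytope P"
  shows "finite (edge_lengths P)"
proof -
  obtain S where S: "finite S" "P = convex hull S" using assms by (auto simp: polytope_def)
  have "{e. is_edge_of e P} \<subseteq> (\<lambda>T. convex hull T) ` Pow S"
  proof
    fix e assume "e \<in> {e. is_edge_of e P}"
    then have "e = convex hull (S \<inter> e)"
      using face_of_convex_hull_finite[OF S(1), of e] S(2) by (simp add: is_edge_of_def)
    then show "e \<in> (\<lambda>T. convex hull T) ` Pow S" by auto
  qed
  then show ?thesis
    unfolding edge_lengths_def using S(1) by (meson finite_Pow_iff finite_imageI finite_subset)
qed

lemma is_edge_of_two_points: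
  assumes "is_edge_of e P"
  obtains x y where "x \<in> e" "y \<in> e" "x \<noteq> y"
proof -
  obtain B where B: "affine hull B = affine hull e" "card B = 2"
    using assms by (auto simp: is_edge_of_def)
  have "\<not> e \<subseteq> {x}" for x
  proof
    assume "e \<subseteq> {x}"
    then have "affine hull e \<subseteq> {x}"
      by (rule hull_minimal) simp
    then have "B \<subseteq> {x}" using B(1) hull_subset[of B affine] by auto
    then show False using B(2) card_mono[of "{x}" B] by auto
  qed
  then show ?thesis using that by (metis all_not_in_conv empty_subsetI singletonI subsetI)
qed

lemma edge_lengths_pos:
  assumes "polytope P" "l \<in> edge_lengths P"
  shows "l > 0"
proof -
  obtain e where e: "is_edge_of e P" "l = diameter e" using assms(2) by (auto simp: edge_lengths_def)
  obtain x y where xy: "x \<in> e" "y \<in> e" "x \<noteq> y" using is_edge_of_two_points[OF e(1)] .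
  have "bounded P" using assms(1) by (auto simp: polytope_def finite_imp_bounded_convex_hull)
  moreover have "e \<subseteq> P" using e(1) by (simp add: is_edge_of_def face_of_imp_subset)
  ultimately have "dist x y \<le> l"
    using xy e(2) by (auto intro: diameter_bounded_bound bounded_subset)
  moreover have "0 < dist x y" using xy(3) by simp
  ultimately show ?thesis by linarith
qed

text \<open>The functional \<open>c\<close> is constant on the line through \<open>a\<close> and
  \<open>b\<close> and larger on the hull of the other generators, so the line misses that hull and
  the segment is a face.\<close>

lemma supported_pair_in_edge_lengths:
  fixes S :: "'a::real_inner set"
  assumes S: "finite S" "a \<in> S" "b \<in> S" "a \<noteq> b" and c: "inner c (b - a) = 0"
    and pos: "\<And>x. x \<in> S - {a, b} \<Longrightarrow> 0 < inner c (x - a)"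
  shows "norm (b - a) \<in> edge_lengths (convex hull S)"
proof -
  have "affine hull {a, b} \<subseteq> {x. inner c x = inner c a}"
    by (rule hull_minimal) (use c in \<open>auto simp: affine_hyperplane inner_diff_right\<close>)
  moreover have "convex hull (S - {a, b}) \<subseteq> {x. inner c x > inner c a}"
    by (rule hull_minimal) (use pos in \<open>auto simp: convex_halfspace_gt inner_diff_right\<close>)
  ultimately have "affine hull {a, b} \<inter> convex hull (S - {a, b}) = {}" by force
  then have "closed_segment a b face_of convex hull S"
    unfolding segment_convex_hull using S by (intro face_of_convex_hulls) auto
  moreover have "affine hull {a, b} = affine hull (closed_segment a b)"
    by (simp add: segment_convex_hull)
  ultimately have "is_edge_of (closed_segment a b) (convex hull S)"
    unfolding is_edge_of_def using S(4) by (intro conjI exI[of _ "{a, b}"]) auto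
  then show ?thesis
    unfolding edge_lengths_def
    by (intro image_eqI[of _ _ "closed_segment a b"]) (auto simp: diameter_closed_segment dist_norm norm_minus_commute)
qed

section \<open>Frames and equivariant vectors\<close>

lift_definition unit_seq :: "nat \<Rightarrow> fin_seq" is "\<lambda>i j. of_bool (j = i)"
  by simp

text \<open>Points of the moment curve: infinitely many vectors, of which at most \<open>n\<close>
  are orthogonal to a given nonzero vector of \<open>R_space n\<close>.\<close>

lift_definition moment_seq :: "nat \<Rightarrow> real \<Rightarrow> fin_seq" is "\<lambda>n t i. if i < n then t ^ i else 0"
  subgoal for n by (rule finite_subset[of _ "{..<n}"]) auto
  done

lemma inner_unit_seq: "inner x (unit_seq i) = coord x i"
proof -
  have "inner (unit_seq i) x = (\<Sum>j\<in>{i}. coord (unit_seq i) j * coord x j)"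
    by (rule inner_fin_seq_superset) (auto simp: unit_seq.rep_eq)
  then show ?thesis by (simp add: inner_commute unit_seq.rep_eq)
qed

lemma coord_diff: "coord (x - y) i = coord x i - coord y i"
  by (simp add: minus_fin_seq.rep_eq)

lemma coord_scaleR: "coord (r *\<^sub>R x) i = r * coord x i"
  by (simp add: scaleR_fin_seq.rep_eq)

lemma norm_unit_seq [simp]: "norm (unit_seq i) = 1"
  by (simp add: norm_eq_sqrt_inner inner_unit_seq unit_seq.rep_eq)

lemma unit_seq_in_R_space: "i < n \<Longrightarrow> unit_seq i \<in> R_space n"
  by (auto simp: R_space_def unit_seq.rep_eq)

lemma moment_seq_in_R_space: "moment_seq n t \<in> R_space n"
  by (auto simp: R_space_def moment_seq.rep_eq)

lemma subspace_R_space: "subspace (R_space n)"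
  by (auto simp: subspace_def R_space_def zero_fin_seq.rep_eq plus_fin_seq.rep_eq scaleR_fin_seq.rep_eq)

lemma norm_R_space:
  assumes "x \<in> R_space n"
  shows "norm x = sqrt (\<Sum>i<n. (coord x i)\<^sup>2)"
  using inner_R_space[OF assms, of x] by (simp add: norm_eq_sqrt_inner power2_eq_square)

text \<open>The inner product is a polynomial in \<open>t\<close> with the coordinates of
  \<open>x\<close> as coefficients. The vanishing coefficient of index \<open>n\<close> is included
  to fit the root bound for sums up to \<open>n\<close>.\<close>

lemma card_orthogonal_moment_seq:
  assumes x: "x \<in> R_space n" "x \<noteq> 0"
  shows "finite {t. inner x (moment_seq n t) = 0}" "card {t. inner x (moment_seq n t) = 0} \<le> n"
proof -
  obtain k where k: "coord x k \<noteq> 0" using x(2) by (metis fin_seq_eqI zero_fin_seq.rep_eq)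
  then have "k \<le> n" using x(1) by (auto simp: R_space_def) (meson nat_le_linear)
  have "inner x (moment_seq n t) = (\<Sum>i\<le>n. coord x i * t ^ i)" for t
  proof -
    have "inner x (moment_seq n t) = (\<Sum>i<n. coord x i * t ^ i)"
      unfolding inner_R_space[OF x(1)] by (rule sum.cong) (auto simp: moment_seq.rep_eq)
    also have "\<dots> = (\<Sum>i\<le>n. coord x i * t ^ i)"
      using x(1) by (simp add: lessThan_Suc_atMost[symmetric] R_space_def)
    finally show ?thesis .
  qed
  then show "finite {t. inner x (moment_seq n t) = 0}" "card {t. inner x (moment_seq n t) = 0} \<le> n"
    using polyfun_rootbound[where c = "coord x" and n = n] k \<open>k \<le> n\<close> by auto
qed

text \<open>The reflection in the hyperplane orthogonal to \<open>y - y'\<close>, which contains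
  \<open>e\<close>; equal norms make it exchange \<open>y\<close> and \<open>y'\<close>.\<close>

lemma reflection_exists:
  fixes y y' e :: fin_seq
  assumes "y \<in> R_space n" "y' \<in> R_space n" "norm y = norm y'" "inner y e = 0" "inner y' e = 0"
  obtains T where "orthogonal_transformation T" "T ` R_space n = R_space n" "T e = e" "T y = y'"
proof -
  define d where "d = y - y'"
  \<comment> \<open>For \<open>d = 0\<close> the quotient is 0 by convention and \<open>T\<close> is
    the identity, as wanted when \<open>y = y'\<close>.\<close>
  define T where "T x = x - (2 * inner x d / inner d d) *\<^sub>R d" for x
  have dR: "d \<in> R_space n" unfolding d_def using assms by (simp add: subspace_diff subspace_R_space)
  have lin: "linear T"
    by (rule linearI) (auto simp: T_def algebra_simps inner_add_left add_divide_distrib)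
  define a where "a x = 2 * inner x d / inner d d" for x
  have a: "a x * inner d d = 2 * inner x d" for x
    by (cases "d = 0") (simp_all add: a_def)
  have Ta: "T x = x - a x *\<^sub>R d" for x by (simp add: T_def a_def)
  have inn: "inner (T x) (T z) = inner x z" for x z
  proof -
    have "inner (T x) (T z) = inner x z - a z * inner x d - a x * inner z d + a z * (a x * inner d d)"
      unfolding Ta by (simp add: inner_diff_left inner_diff_right inner_commute[of d z] algebra_simps)
    moreover have "a z * inner x d = a x * inner z d" by (simp add: a_def)
    ultimately show ?thesis unfolding a by simp
  qed
  have TT: "T (T x) = x" for x
  proof -
    have "inner (T x) d = - inner x d" using a[of x] unfolding Ta by (simp add: inner_diff_left)
    then have "a (T x) = - a x" by (simp add: a_def)
    then show ?thesis by (simp add: Ta[of "T x"]) (simp add: Ta)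
  qed
  have TR: "T x \<in> R_space n" if "x \<in> R_space n" for x
    unfolding T_def using that dR by (intro subspace_diff subspace_scale subspace_R_space)
  have "T ` R_space n = R_space n"
    using TR TT by (metis (no_types, lifting) image_eqI subsetI subset_antisym image_subsetI)
  moreover have "T e = e"
    using assms by (simp add: T_def d_def inner_diff_right inner_commute[of e])
  moreover have "T y = y'"
  proof (cases "d = 0")
    case False
    have "inner y y = inner y' y'" using assms(3) by (simp add: norm_eq_sqrt_inner)
    then have "2 * inner y d = inner d d"
      by (simp add: d_def inner_diff_left inner_diff_right inner_commute)
    then show ?thesis using False by (simp add: T_def) (simp add: d_def)
  qed (simp add: T_def d_def)
  moreover have "orthogonal_transformation T"
    using lin inn by (simp add: orthogonal_transformation_def)
  ultimately show ?thesis using that by blast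
qed

section \<open>Measurability on the space of frames and invariance of integrals\<close>

lemma continuous_on_orthogonal_transformation:
  fixes T :: "'a::real_inner \<Rightarrow> 'a"
  assumes "orthogonal_transformation T"
  shows "continuous_on A T"
proof -
  have "bounded_linear T"
    using assms
    by (intro bounded_linear_intro[where K = 1])
       (auto simp: orthogonal_transformation_def linear_add linear_scale norm_eq_sqrt_inner)
  then show ?thesis by (simp add: linear_continuous_on)
qed

lemma frame_measurable:
  fixes g :: "fin_seq \<times> fin_seq \<Rightarrow> real"
  assumes "uniform_2_frame n \<mu>" "continuous_on UNIV g"
  shows "g \<in> borel_measurable \<mu>"
proof -
  have "g \<in> borel_measurable (restrict_space borel (orthonormal_2_frames n))"
    using assms(2) by (intro borel_measurable_continuous_on_restrict) (rule continuous_on_subset, auto)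
  then show ?thesis
    using assms(1) by (simp add: uniform_2_frame_def cong: measurable_cong_sets)
qed

lemma frame_map_measurable:
  assumes \<mu>: "uniform_2_frame n \<mu>" and T: "orthogonal_transformation T" "T ` R_space n = R_space n"
  shows "map_prod T T \<in> measurable \<mu> \<mu>"
proof -
  have iso: "inner (T x) (T y) = inner x y" for x y
    using T(1) by (simp add: orthogonal_transformation_def)
  have sets: "sets \<mu> = sets (restrict_space borel (orthonormal_2_frames n))"
    and sp: "space \<mu> = orthonormal_2_frames n"
    using \<mu> by (simp_all add: uniform_2_frame_def)
  have "map_prod T T \<in> measurable (restrict_space borel (orthonormal_2_frames n)) borel"
    unfolding map_prod_def case_prod_unfold
    by (intro borel_measurable_continuous_on_restrict continuous_intros
        continuous_on_compose2[OF continuous_on_orthogonal_transformation[OF T(1), of UNIV]]) auto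
  moreover have "map_prod T T f \<in> orthonormal_2_frames n" if "f \<in> orthonormal_2_frames n" for f
    using that T(2) by (auto simp: orthonormal_2_frames_def norm_eq_sqrt_inner iso; blast)
  ultimately have "map_prod T T \<in> measurable (restrict_space borel (orthonormal_2_frames n))
      (restrict_space borel (orthonormal_2_frames n))"
    by (intro measurable_restrict_space2) (auto simp: space_restrict_space)
  then show ?thesis using sets by (simp cong: measurable_cong_sets)
qed

lemma frame_nn_integral_invariant:
  assumes \<mu>: "uniform_2_frame n \<mu>" and T: "orthogonal_transformation T" "T ` R_space n = R_space n"
    and g: "g \<in> borel_measurable \<mu>"
  shows "(\<integral>\<^sup>+ f. g (map_prod T T f) \<partial>\<mu>) = (\<integral>\<^sup>+ f. g f \<partial>\<mu>)"
proof -
  have "distr \<mu> \<mu> (map_prod T T) = \<mu>" using \<mu> T by (simp add: uniform_2_frame_def)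
  then show ?thesis
    using nn_integral_distr[OF frame_map_measurable[OF \<mu> T], of g] g by simp
qed

text \<open>The instances are the first frame vector, with \<open>e = 0\<close>, and
  \<open>frame_cross e\<close>. Equivariance under the orthogonal maps fixing \<open>e\<close> makes
  the law of \<open>X\<close> rotationally symmetric in the complement of \<open>e\<close>.
  Measurability is required of scalar products only; norms are recovered from finitely many
  coordinates.\<close>

locale equivariant_frame_vector =
  fixes n :: nat and \<mu> :: "(fin_seq \<times> fin_seq) measure" and e :: fin_seq
    and X :: "fin_seq \<times> fin_seq \<Rightarrow> fin_seq" and C :: real
  assumes n2: "2 \<le> n" and uniform: "uniform_2_frame n \<mu>" and e_in: "e \<in> R_space n"
    and X_in: "f \<in> orthonormal_2_frames n \<Longrightarrow> X f \<in> R_space n"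
    and X_perp: "f \<in> orthonormal_2_frames n \<Longrightarrow> inner (X f) e = 0"
    and X_bound: "f \<in> orthonormal_2_frames n \<Longrightarrow> norm (X f) \<le> C"
    and X_equivariant: "orthogonal_transformation T \<Longrightarrow> T ` R_space n = R_space n \<Longrightarrow> T e = e \<Longrightarrow>
          f \<in> orthonormal_2_frames n \<Longrightarrow> X (map_prod T T f) = T (X f)"
    and X_measurable [measurable]: "(\<lambda>f. inner (X f) y) \<in> borel_measurable \<mu>"
begin

sublocale prob_space \<mu>
  using uniform by (simp add: uniform_2_frame_def)

lemma space_frames: "space \<mu> = orthonormal_2_frames n"
  using uniform by (simp add: uniform_2_frame_def)

lemma X_in_space: "f \<in> space \<mu> \<Longrightarrow> X f \<in> R_space n"
  by (simp add: space_frames X_in)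

lemma norm_X_measurable [measurable]: "(\<lambda>f. norm (X f)) \<in> borel_measurable \<mu>"
proof -
  have "(\<lambda>f. sqrt (\<Sum>i<n. (inner (X f) (unit_seq i))\<^sup>2)) \<in> borel_measurable \<mu>"
    by measurable
  then show ?thesis
    by (rule measurable_cong[THEN iffD1, rotated]) (simp add: norm_R_space[OF X_in_space] inner_unit_seq)
qed

lemma inner_X_X_measurable [measurable]:
  "(\<lambda>p. inner (X (fst p)) (X (snd p))) \<in> borel_measurable (\<mu> \<Otimes>\<^sub>M \<mu>)"
proof -
  have "(\<lambda>p. \<Sum>i<n. inner (X (fst p)) (unit_seq i) * inner (X (snd p)) (unit_seq i))
      \<in> borel_measurable (\<mu> \<Otimes>\<^sub>M \<mu>)"
    by measurable
  then show ?thesis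
    by (rule measurable_cong[THEN iffD1, rotated])
       (auto simp: inner_R_space[OF X_in_space] inner_unit_seq space_pair_measure)
qed

text \<open>A reflection fixing \<open>e\<close> and moving \<open>y\<close> to \<open>y'\<close>
  preserves the measure, so the joint law of the norm of \<open>X f\<close> and its product with
  \<open>y\<close> depends on \<open>y\<close> only through the norm of \<open>y\<close>.\<close>

lemma nn_integral_direction_invariant:
  fixes \<Phi> :: "real \<times> real \<Rightarrow> ennreal"
  assumes y: "y \<in> R_space n" "y' \<in> R_space n" "norm y = norm y'" "inner y e = 0" "inner y' e = 0"
    and [measurable]: "\<Phi> \<in> borel_measurable borel"
  shows "(\<integral>\<^sup>+ f. \<Phi> (norm (X f), inner (X f) y) \<partial>\<mu>) = (\<integral>\<^sup>+ f. \<Phi> (norm (X f), inner (X f) y') \<partial>\<mu>)"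
proof -
  obtain T where T: "orthogonal_transformation T" "T ` R_space n = R_space n" "T e = e" "T y = y'"
    using reflection_exists[OF y] .
  have iso: "inner (T x) (T z) = inner x z" for x z
    using T(1) by (simp add: orthogonal_transformation_def)
  have "(\<integral>\<^sup>+ f. \<Phi> (norm (X f), inner (X f) y') \<partial>\<mu>)
      = (\<integral>\<^sup>+ f. \<Phi> (norm (X (map_prod T T f)), inner (X (map_prod T T f)) y') \<partial>\<mu>)"
    by (rule frame_nn_integral_invariant[OF uniform T(1,2), symmetric]) measurable
  also have "\<dots> = (\<integral>\<^sup>+ f. \<Phi> (norm (X f), inner (X f) y) \<partial>\<mu>)"
    by (intro nn_integral_cong)
       (simp add: X_equivariant[OF T(1-3)] space_frames norm_eq_sqrt_inner iso T(4)[symmetric])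
  finally show ?thesis ..
qed

end

section \<open>Almost sure non-orthogonality, and the mean norm of \<open>X\<close> over cones of
  directions\<close>

lemma inner_diff_unit:
  fixes a b :: "'a::real_inner"
  assumes "norm a = 1" "norm b = 1"
  shows "inner (a - b) (a - b) = 2 - 2 * inner a b"
  using assms by (simp add: inner_diff_left inner_diff_right inner_commute[of b a] norm_eq_1)

context equivariant_frame_vector
begin

text \<open>Orthogonality ignores the length of \<open>y'\<close>, which is rescaled to that of
  \<open>y\<close> before invariance is applied.\<close>

lemma prob_orthogonal_eq:
  assumes y: "y \<in> R_space n" "y' \<in> R_space n" "y \<noteq> 0" "y' \<noteq> 0" "inner y e = 0" "inner y' e = 0"
  shows "prob {f\<in>space \<mu>. X f \<noteq> 0 \<and> inner (X f) y = 0} = prob {f\<in>space \<mu>. X f \<noteq> 0 \<and> inner (X f) y' = 0}"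
proof -
  define z where "z = (norm y / norm y') *\<^sub>R y'"
  have z: "z \<in> R_space n" "norm z = norm y" "inner z e = 0"
    using y by (auto simp: z_def intro: subspace_scale subspace_R_space)
  let ?\<Phi> = "\<lambda>p::real \<times> real. indicator {p. fst p \<noteq> 0 \<and> snd p = 0} p :: ennreal"
  have Phi: "?\<Phi> \<in> borel_measurable borel"
    unfolding borel_prod[symmetric] by measurable
  have eq: "(\<integral>\<^sup>+ f. ?\<Phi> (norm (X f), inner (X f) w) \<partial>\<mu>) = emeasure \<mu> {f\<in>space \<mu>. X f \<noteq> 0 \<and> inner (X f) w = 0}" for w
  proof -
    have "{f\<in>space \<mu>. norm (X f) \<noteq> 0 \<and> inner (X f) w = 0} \<in> sets \<mu>" by measurable
    then have "emeasure \<mu> {f\<in>space \<mu>. X f \<noteq> 0 \<and> inner (X f) w = 0}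
        = (\<integral>\<^sup>+ f. indicator {f\<in>space \<mu>. X f \<noteq> 0 \<and> inner (X f) w = 0} f \<partial>\<mu>)"
      by simp
    also have "\<dots> = (\<integral>\<^sup>+ f. ?\<Phi> (norm (X f), inner (X f) w) \<partial>\<mu>)"
      by (intro nn_integral_cong) (auto split: split_indicator)
    finally show ?thesis ..
  qed
  have "emeasure \<mu> {f\<in>space \<mu>. X f \<noteq> 0 \<and> inner (X f) y = 0} = emeasure \<mu> {f\<in>space \<mu>. X f \<noteq> 0 \<and> inner (X f) z = 0}"
    using nn_integral_direction_invariant[OF y(1) z(1) z(2)[symmetric] y(5) z(3) Phi] unfolding eq .
  moreover have "inner x z = 0 \<longleftrightarrow> inner x y' = 0" for x
    using y by (simp add: z_def)
  ultimately show ?thesis by (simp add: measure_def)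
qed

text \<open>All directions orthogonal to \<open>e\<close> have the same probability
  \<open>?p\<close> of being orthogonal to a nonzero \<open>X f\<close>. Among \<open>N\<close>
  directions taken from the moment curve the expected number of such is \<open>N * ?p\<close>, yet
  it never exceeds \<open>n\<close>; hence \<open>?p = 0\<close>.\<close>

lemma AE_not_orthogonal:
  assumes y: "y \<in> R_space n" "y \<noteq> 0" "inner y e = 0"
  shows "AE f in \<mu>. X f = 0 \<or> inner (X f) y \<noteq> 0"
proof -
  let ?B = "\<lambda>y. {f\<in>space \<mu>. X f \<noteq> 0 \<and> inner (X f) y = 0}"
  have B: "?B y \<in> sets \<mu>" for y
  proof -
    have "{f\<in>space \<mu>. norm (X f) \<noteq> 0 \<and> inner (X f) y = 0} \<in> sets \<mu>" by measurable
    then show ?thesis by simp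
  qed
  \<comment> \<open>The component of the moment curve orthogonal to \<open>e\<close>. As
    \<open>X f\<close> is orthogonal to \<open>e\<close>, products with \<open>X f\<close> are
    unchanged.\<close>
  define w where "w t = moment_seq n t - (inner (moment_seq n t) e / inner e e) *\<^sub>R e" for t
  \<comment> \<open>If \<open>w t = 0\<close>, the curve point is a multiple of \<open>e\<close>,
    and its first two coordinates 1 and \<open>t\<close>, present because \<open>2 \<le> n\<close>,
    determine \<open>t\<close> as a quotient of coordinates of \<open>e\<close>.\<close>
  obtain t0 where t0: "\<And>t. t > t0 \<Longrightarrow> w t \<noteq> 0"
  proof (rule that)
    fix t assume t: "t > \<bar>coord e 1 / coord e 0\<bar>"
    show "w t \<noteq> 0"
    proof
      assume "w t = 0"
      then obtain r where r: "moment_seq n t = r *\<^sub>R e" by (auto simp: w_def)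
      have "1 = r * coord e 0" "t = r * coord e 1"
        using arg_cong[OF r, of "\<lambda>x. coord x 0"] arg_cong[OF r, of "\<lambda>x. coord x 1"] n2
        by (auto simp: moment_seq.rep_eq coord_scaleR)
      then have "coord e 0 \<noteq> 0" "t = r * coord e 1" by auto
      moreover from this \<open>1 = r * coord e 0\<close> have "r = 1 / coord e 0" by (simp add: nonzero_eq_divide_eq)
      ultimately have "t = coord e 1 / coord e 0" by simp
      then show False using t by linarith
    qed
  qed
  have wR: "w t \<in> R_space n" for t
    unfolding w_def using e_in by (intro subspace_diff subspace_scale subspace_R_space moment_seq_in_R_space)
  have we: "inner (w t) e = 0" for t
    by (cases "e = 0") (simp_all add: w_def inner_diff_left)
  have inw: "inner (X f) (w t) = inner (X f) (moment_seq n t)" if "f \<in> space \<mu>" for f t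
    using X_perp[of f] that by (simp add: w_def inner_diff_right space_frames)
  let ?p = "prob (?B y)"
  have bound: "real N * ?p \<le> real n" for N
  proof -
    let ?t = "\<lambda>j::nat. \<bar>t0\<bar> + 1 + real j"
    have "real N * ?p = (\<Sum>j<N. prob (?B (w (?t j))))"
    proof -
      have "prob (?B (w (?t j))) = ?p" for j
        by (rule prob_orthogonal_eq) (use y wR we t0 in auto)
      then show ?thesis by simp
    qed
    also have "\<dots> = (\<Sum>j<N. expectation (indicator (?B (w (?t j)))))"
      using B by (simp add: Int_absorb1 subset_eq)
    also have "\<dots> = expectation (\<lambda>f. \<Sum>j<N. indicator (?B (w (?t j))) f)"
      using B by (subst Bochner_Integration.integral_sum) (auto intro!: integrable_real_indicator simp: less_top[symmetric])
    also have "\<dots> \<le> real n"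
    proof (rule integral_le_const)
      show "integrable \<mu> (\<lambda>f. \<Sum>j<N. indicator (?B (w (?t j))) f :: real)"
        using B by (intro Bochner_Integration.integrable_sum) (auto intro!: integrable_real_indicator simp: less_top[symmetric])
      show "AE f in \<mu>. (\<Sum>j<N. indicator (?B (w (?t j))) f) \<le> real n"
      proof (rule AE_I2)
        fix f assume f: "f \<in> space \<mu>"
        show "(\<Sum>j<N. indicator (?B (w (?t j))) f) \<le> real n"
        proof (cases "X f = 0")
          case False
          have "(\<Sum>j<N. indicator (?B (w (?t j))) f) = (\<Sum>j<N. if inner (X f) (w (?t j)) = 0 then 1 else (0::real))"
            using False f by (intro sum.cong) (auto split: split_indicator)
          also have "\<dots> = real (card {j\<in>{..<N}. inner (X f) (w (?t j)) = 0})"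
            by (simp add: sum.If_cases Int_def)
          also have "card {j\<in>{..<N}. inner (X f) (w (?t j)) = 0} \<le> card {t. inner (X f) (moment_seq n t) = 0}"
            using card_orthogonal_moment_seq(1)[OF X_in_space[OF f] False] inw[OF f]
            by (intro card_inj_on_le[where f = ?t]) (auto simp: inj_on_def)
          also have "\<dots> \<le> n"
            by (rule card_orthogonal_moment_seq(2)[OF X_in_space[OF f] False])
          finally show ?thesis by simp
        qed simp
      qed
    qed
    finally show ?thesis .
  qed
  have "?p = 0"
  proof (rule ccontr)
    assume "?p \<noteq> 0"
    then have "0 < ?p" by (simp add: zero_less_measure_iff)
    then obtain N where "real n < real N * ?p" using reals_Archimedean3 by blast
    then show False using bound[of N] by simp
  qed
  then have "?B y \<in> null_sets \<mu>"
    using B by (auto simp: null_sets_def emeasure_eq_measure)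
  then show ?thesis
    by (rule AE_I') auto
qed

lemma AE_inner_nonzero:
  assumes ne: "AE f in \<mu>. X f \<noteq> 0" and g: "g \<in> R_space n" "\<And>r. g \<noteq> r *\<^sub>R e"
  shows "AE f in \<mu>. inner (X f) g \<noteq> 0"
proof -
  define y where "y = g - (inner g e / inner e e) *\<^sub>R e"
  have nonorth: "AE f in \<mu>. X f = 0 \<or> inner (X f) y \<noteq> 0"
  proof (rule AE_not_orthogonal)
    show "y \<in> R_space n" unfolding y_def using g e_in by (intro subspace_diff subspace_scale subspace_R_space)
    show "y \<noteq> 0" using g(2) by (auto simp: y_def)
    show "inner y e = 0" by (cases "e = 0") (simp_all add: y_def inner_diff_left)
  qed
  have "inner (X f) y = inner (X f) g" if "f \<in> space \<mu>" for f
    using X_perp[of f] that by (simp add: y_def inner_diff_right space_frames)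
  then show ?thesis by - (rule AE_mp[OF nonorth], rule AE_mp[OF ne], rule AE_I2, auto)
qed

text \<open>Directions are sorted into cells by rounding their coordinates. There are countably many
  cells, each inside the cap around any of its members; if all caps were null sets, \<open>X\<close>
  would vanish almost surely.\<close>

lemma cap_positive:
  assumes ne: "AE f in \<mu>. X f \<noteq> 0" and \<epsilon>: "\<epsilon> > 0"
  shows "\<exists>f0\<in>space \<mu>. X f0 \<noteq> 0 \<and>
    emeasure \<mu> {f\<in>space \<mu>. (1 - \<epsilon>) * norm (X f) * norm (X f0) < inner (X f) (X f0)} > 0"
proof (rule ccontr)
  assume contra: "\<not> ?thesis"
  \<comment> \<open>Directions in one cell differ by at most \<open>1 / K\<close> in each
    coordinate, so their squared distance is at most \<open>n / K < 2 * \<epsilon>\<close>; for unit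
    vectors this means an inner product above \<open>1 - \<epsilon>\<close>.\<close>
  define K where "K = real n / (2 * \<epsilon>) + 1"
  have K: "K \<ge> 1" "K > real n / (2 * \<epsilon>)" using \<epsilon> by (auto simp: K_def)
  define cell where "cell f = map (\<lambda>i. \<lfloor>K * (coord (X f) i / norm (X f))\<rfloor>) [0..<n]" for f
  let ?cap = "\<lambda>f0. {f\<in>space \<mu>. (1 - \<epsilon>) * norm (X f) * norm (X f0) < inner (X f) (X f0)}"
  define rep where "rep l = (SOME f0. f0 \<in> space \<mu> \<and> X f0 \<noteq> 0 \<and> cell f0 = l)" for l
  define L where "L = cell ` {f\<in>space \<mu>. X f \<noteq> 0}"
  have rep: "rep l \<in> space \<mu> \<and> X (rep l) \<noteq> 0 \<and> cell (rep l) = l" if "l \<in> L" for l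
    unfolding rep_def by (rule someI_ex) (use that in \<open>auto simp: L_def\<close>)
  have "?cap (rep l) \<in> null_sets \<mu>" if "l \<in> L" for l
  proof (rule null_setsI)
    show "?cap (rep l) \<in> sets \<mu>" by measurable
    show "emeasure \<mu> (?cap (rep l)) = 0"
      using contra rep[OF that] by (auto simp: zero_less_iff_neq_zero)
  qed
  then have "(\<Union>l\<in>L. ?cap (rep l)) \<in> null_sets \<mu>"
    by (intro null_sets_UN') auto
  moreover have "{f\<in>space \<mu>. X f \<noteq> 0} \<subseteq> (\<Union>l\<in>L. ?cap (rep l))"
  proof safe
    fix f assume f: "f \<in> space \<mu>" "X f \<noteq> 0"
    define g where "g = rep (cell f)"
    have g: "g \<in> space \<mu>" "X g \<noteq> 0" "cell g = cell f"
      using rep[of "cell f"] f by (auto simp: g_def L_def)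
    define a where "a = X f /\<^sub>R norm (X f)"
    define b where "b = X g /\<^sub>R norm (X g)"
    have ab: "norm a = 1" "norm b = 1" "a - b \<in> R_space n"
      using f g X_in_space[of f] X_in_space[of g]
      by (auto simp: a_def b_def intro!: subspace_diff subspace_scale subspace_R_space)
    have "\<bar>coord (a - b) i\<bar> \<le> 1 / K" if "i < n" for i
    proof -
      have "\<lfloor>K * coord a i\<rfloor> = \<lfloor>K * coord b i\<rfloor>"
        using g(3) that by (auto simp: cell_def a_def b_def coord_scaleR divide_inverse mult.commute dest: map_eq_conv[THEN iffD1])
      then have "\<bar>K * coord a i - K * coord b i\<bar> \<le> 1" by linarith
      then show ?thesis using K(1) by (simp add: coord_diff abs_mult pos_le_divide_eq mult.commute[of _ K] flip: right_diff_distrib)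
    qed
    then have "(\<Sum>i<n. (coord (a - b) i)\<^sup>2) \<le> (\<Sum>i<n. (1 / K)\<^sup>2)"
      using K(1) by (intro sum_mono power2_le_iff_abs_le[THEN iffD2]) auto
    also have "\<dots> \<le> real n / K"
      using K(1) mult_right_mono[of 1 K "real n"] by (simp add: power2_eq_square field_simps)
    also have "\<dots> < 2 * \<epsilon>" using K \<epsilon> by (simp add: field_simps)
    finally have "inner (a - b) (a - b) < 2 * \<epsilon>"
      using inner_R_space[OF ab(3), of "a - b"] by (simp add: power2_eq_square)
    then have "1 - \<epsilon> < inner a b"
      using inner_diff_unit[OF ab(1,2)] by simp
    then have "(1 - \<epsilon>) * norm (X f) * norm (X g) < inner (X f) (X g)"
      using f g by (simp add: a_def b_def field_simps)
    then show "f \<in> (\<Union>l\<in>L. ?cap (rep l))"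
      using f unfolding g_def L_def by blast
  qed
  ultimately have "AE f in \<mu>. X f = 0" by (intro AE_I') auto
  with ne have "AE f in \<mu>. False" by eventually_elim auto
  then show False by simp
qed

text \<open>
  Averaging a cap around a random direction over a second, independent copy compares
  the \<open>norm X\<close>-weighted distribution of directions with the unweighted one; shrinking the caps
  localises the comparison to an open cone.
\<close>

lemma nn_integral_norm_open_cone_le:
  assumes ne: "AE f in \<mu>. X f \<noteq> 0"
    and N: "open N" "\<And>r z. 0 < r \<Longrightarrow> z \<in> N \<Longrightarrow> r *\<^sub>R z \<in> N"
    and N_meas [measurable]: "Measurable.pred \<mu> (\<lambda>f. X f \<in> N)"
  shows "(\<integral>\<^sup>+ f. ennreal (norm (X f)) * indicator {f\<in>space \<mu>. X f \<in> N} f \<partial>\<mu>)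
     \<le> (\<integral>\<^sup>+ f. ennreal (norm (X f)) \<partial>\<mu>) * emeasure \<mu> {f\<in>space \<mu>. X f \<in> N}"
proof -
  let ?N = "{f\<in>space \<mu>. X f \<in> N}"
  let ?\<rho> = "\<integral>\<^sup>+ f. ennreal (norm (X f)) \<partial>\<mu>"
  define \<Phi> :: "nat \<Rightarrow> real \<times> real \<Rightarrow> ennreal" where
    "\<Phi> j p = (if (1 - 1 / Suc j) * fst p < snd p then 1 else 0)" for j p
  \<comment> \<open>Indicator that the angle between \<open>X f\<close> and \<open>X g\<close> has
    cosine above \<open>1 - 1 / Suc j\<close>, written without quotients; it is symmetric and
    vanishes when either vector is zero.\<close>
  define k :: "nat \<Rightarrow> _ \<Rightarrow> _ \<Rightarrow> ennreal" where
    "k j f g = (if (1 - 1 / Suc j) * norm (X f) * norm (X g) < inner (X f) (X g) then 1 else 0)"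
    for j f g
  have \<Phi>_meas: "\<Phi> j \<in> borel_measurable borel" "(\<lambda>p. ennreal (fst p) * \<Phi> j p) \<in> borel_measurable borel" for j
    unfolding \<Phi>_def borel_prod[symmetric] by measurable
  have k_sym: "k j f g = k j g f" for j f g
    by (simp add: k_def inner_commute mult_ac)
  have k_meas [measurable]: "(\<lambda>p. k j (fst p) (snd p)) \<in> borel_measurable (\<mu> \<Otimes>\<^sub>M \<mu>)" for j
    unfolding k_def by measurable
  have k_meas1 [measurable]: "(\<lambda>f. k j f g) \<in> borel_measurable \<mu>" for j g
    unfolding k_def by measurable
  have k_meas2 [measurable]: "(\<lambda>g. k j f g) \<in> borel_measurable \<mu>" for j f
    using k_meas1[of j f] unfolding k_sym[of j f] .
  define hat where "hat g = X g /\<^sub>R norm (X g)" for g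
  have hat: "hat g \<in> R_space n" "inner (hat g) e = 0" "X g \<noteq> 0 \<Longrightarrow> norm (hat g) = 1" if "g \<in> space \<mu>" for g
    using that X_in_space[of g] X_perp[of g]
    by (auto simp: hat_def space_frames intro!: subspace_scale subspace_R_space)
  have k_hat: "k j f g = \<Phi> j (norm (X f), inner (X f) (hat g))" if "X g \<noteq> 0" for j f g
    using that by (auto simp: k_def \<Phi>_def hat_def field_simps)
  have "\<forall>j. \<exists>A B. 0 < B \<and> B < \<top> \<and> (\<forall>g\<in>space \<mu>. X g \<noteq> 0 \<longrightarrow> (\<integral>\<^sup>+ f. k j f g \<partial>\<mu>) = B \<and>
      (\<integral>\<^sup>+ f. ennreal (norm (X f)) * k j f g \<partial>\<mu>) = A)"
  proof
    fix j
    obtain f0 where f0: "f0 \<in> space \<mu>" "X f0 \<noteq> 0"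
      "emeasure \<mu> {f\<in>space \<mu>. (1 - 1 / Suc j) * norm (X f) * norm (X f0) < inner (X f) (X f0)} > 0"
      using cap_positive[OF ne, of "1 / Suc j"] by auto
    let ?B = "\<integral>\<^sup>+ f. k j f f0 \<partial>\<mu>"
    let ?cap = "{f\<in>space \<mu>. (1 - 1 / Suc j) * norm (X f) * norm (X f0) < inner (X f) (X f0)}"
    have "?B = (\<integral>\<^sup>+ f. indicator ?cap f \<partial>\<mu>)"
      by (intro nn_integral_cong) (simp add: k_def)
    also have "\<dots> = emeasure \<mu> ?cap" by (rule nn_integral_indicator) measurable
    finally have "?B = emeasure \<mu> ?cap" .
    then have "0 < ?B" "?B < \<top>" using f0(3) by (auto simp: emeasure_eq_measure)
    moreover have "(\<integral>\<^sup>+ f. k j f g \<partial>\<mu>) = ?B \<and>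
      (\<integral>\<^sup>+ f. ennreal (norm (X f)) * k j f g \<partial>\<mu>) = (\<integral>\<^sup>+ f. ennreal (norm (X f)) * k j f f0 \<partial>\<mu>)"
      if g: "g \<in> space \<mu>" "X g \<noteq> 0" for g
    proof -
      have nn: "norm (hat g) = norm (hat f0)" using hat(3)[OF g] hat(3)[OF f0(1,2)] by simp
      note inv = nn_integral_direction_invariant[OF hat(1)[OF g(1)] hat(1)[OF f0(1)] nn hat(2)[OF g(1)] hat(2)[OF f0(1)]]
      show ?thesis
        using inv[OF \<Phi>_meas(1), of j] inv[OF \<Phi>_meas(2), of j] by (simp add: k_hat g f0)
    qed
    ultimately show "\<exists>A B. 0 < B \<and> B < \<top> \<and> (\<forall>g\<in>space \<mu>. X g \<noteq> 0 \<longrightarrow> (\<integral>\<^sup>+ f. k j f g \<partial>\<mu>) = B \<and>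
      (\<integral>\<^sup>+ f. ennreal (norm (X f)) * k j f g \<partial>\<mu>) = A)" by blast
  qed
  then obtain A B where B: "\<And>j. 0 < B j" "\<And>j. B j < \<top>"
    and kB: "\<And>j g. g \<in> space \<mu> \<Longrightarrow> X g \<noteq> 0 \<Longrightarrow> (\<integral>\<^sup>+ f. k j f g \<partial>\<mu>) = B j"
    and kA: "\<And>j g. g \<in> space \<mu> \<Longrightarrow> X g \<noteq> 0 \<Longrightarrow> (\<integral>\<^sup>+ f. ennreal (norm (X f)) * k j f g \<partial>\<mu>) = A j"
    unfolding choice_iff by blast
  have kB': "(\<integral>\<^sup>+ g. k j f g \<partial>\<mu>) = B j" if "f \<in> space \<mu>" "X f \<noteq> 0" for j f
    using kB[OF that, of j] by (simp add: k_sym[of j f])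
  interpret pair_sigma_finite \<mu> \<mu> ..
  \<comment> \<open>\<open>A j\<close> and \<open>B j\<close> do not depend on the centre of the
    cap. Averaging over the centre and exchanging the integrals evaluates the weighted cap
    integral.\<close>
  have A: "A j = ?\<rho> * B j" for j
  proof -
    have "A j = (\<integral>\<^sup>+ g. A j \<partial>\<mu>)" by (simp add: emeasure_space_1)
    also have "\<dots> = (\<integral>\<^sup>+ g. (\<integral>\<^sup>+ f. ennreal (norm (X f)) * k j f g \<partial>\<mu>) \<partial>\<mu>)"
      by (rule nn_integral_cong_AE) (rule AE_mp[OF ne], rule AE_I2, simp add: kA)
    also have "\<dots> = (\<integral>\<^sup>+ f. (\<integral>\<^sup>+ g. ennreal (norm (X f)) * k j f g \<partial>\<mu>) \<partial>\<mu>)"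
      by (rule Fubini') (simp add: case_prod_unfold)
    also have "\<dots> = (\<integral>\<^sup>+ f. ennreal (norm (X f)) * B j \<partial>\<mu>)"
      by (rule nn_integral_cong_AE) (rule AE_mp[OF ne], rule AE_I2, simp add: nn_integral_cmult kB')
    also have "\<dots> = ?\<rho> * B j" by (simp add: nn_integral_multc)
    finally show ?thesis .
  qed
  have indN [measurable]: "?N \<in> sets \<mu>" by measurable
  \<comment> \<open>The proportion of the cap around \<open>X f\<close> that lies in
    \<open>N\<close>, measured by the law of \<open>X\<close>.\<close>
  define G where "G j f = (\<integral>\<^sup>+ g. k j f g * indicator ?N g \<partial>\<mu>) / B j" for j f
  have G_meas [measurable]: "G j \<in> borel_measurable \<mu>" for j
    unfolding G_def by measurable
  have G_int: "(\<integral>\<^sup>+ f. ennreal (norm (X f)) * G j f \<partial>\<mu>) = ?\<rho> * emeasure \<mu> ?N" for j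
  proof -
    have "(\<integral>\<^sup>+ f. ennreal (norm (X f)) * G j f \<partial>\<mu>)
      = (\<integral>\<^sup>+ f. (\<integral>\<^sup>+ g. ennreal (norm (X f)) * k j f g * indicator ?N g \<partial>\<mu>) / B j \<partial>\<mu>)"
      unfolding G_def
      by (intro nn_integral_cong) (simp add: nn_integral_cmult mult.assoc ennreal_times_divide)
    also have "\<dots> = (\<integral>\<^sup>+ f. (\<integral>\<^sup>+ g. ennreal (norm (X f)) * k j f g * indicator ?N g \<partial>\<mu>) \<partial>\<mu>) / B j"
      by (rule nn_integral_divide) measurable
    also have "(\<integral>\<^sup>+ f. (\<integral>\<^sup>+ g. ennreal (norm (X f)) * k j f g * indicator ?N g \<partial>\<mu>) \<partial>\<mu>)
       = (\<integral>\<^sup>+ g. (\<integral>\<^sup>+ f. ennreal (norm (X f)) * k j f g * indicator ?N g \<partial>\<mu>) \<partial>\<mu>)"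
      by (rule Fubini'[symmetric]) (simp add: case_prod_unfold)
    also have "\<dots> = (\<integral>\<^sup>+ g. A j * indicator ?N g \<partial>\<mu>)"
      by (rule nn_integral_cong_AE) (rule AE_mp[OF ne], rule AE_I2, simp add: nn_integral_multc kA)
    also have "\<dots> = A j * emeasure \<mu> ?N" by (simp add: nn_integral_cmult_indicator)
    also have "A j * emeasure \<mu> ?N / B j = ?\<rho> * emeasure \<mu> ?N"
    proof -
      have "A j * emeasure \<mu> ?N = ?\<rho> * emeasure \<mu> ?N * B j" by (simp add: A mult_ac)
      then show ?thesis using B[of j] by (simp add: ennreal_mult_divide_eq less_top)
    qed
    finally show ?thesis .
  qed
  have "(\<integral>\<^sup>+ f. ennreal (norm (X f)) * indicator ?N f \<partial>\<mu>)
     \<le> (\<integral>\<^sup>+ f. liminf (\<lambda>j. ennreal (norm (X f)) * G j f) \<partial>\<mu>)"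
  proof (rule nn_integral_mono_AE, rule AE_mp[OF ne], rule AE_I2, rule impI)
    fix f assume f: "f \<in> space \<mu>" "X f \<noteq> 0"
    show "ennreal (norm (X f)) * indicator ?N f \<le> liminf (\<lambda>j. ennreal (norm (X f)) * G j f)"
    proof (cases "X f \<in> N")
      case True
      have "hat f \<in> N" using N(2)[OF _ True] f by (simp add: hat_def)
      then obtain \<delta> where \<delta>: "\<delta> > 0" "ball (hat f) \<delta> \<subseteq> N" using N(1) open_contains_ball by blast
      have "eventually (\<lambda>j. 1 / Suc j < \<delta>\<^sup>2 / 2) sequentially"
        using \<delta>(1) by (intro order_tendstoD(2)[OF LIMSEQ_Suc[OF lim_1_over_n, THEN tendsto_eq_rhs]]) auto
      \<comment> \<open>Once the cap fits into the ball of radius \<open>\<delta>\<close> around the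
        direction of \<open>X f\<close>, it lies entirely in the cone \<open>N\<close>.\<close>
      then have "eventually (\<lambda>j. G j f = 1) sequentially"
      proof eventually_elim
        case (elim j)
        have in_N: "X g \<in> N" if "k j f g \<noteq> 0" "g \<in> space \<mu>" for g
        proof -
          have lt: "(1 - 1 / Suc j) * norm (X f) * norm (X g) < inner (X f) (X g)"
            using that by (simp add: k_def split: if_splits)
          then have g0: "X g \<noteq> 0" by auto
          have "1 - 1 / Suc j < inner (hat f) (hat g)"
            using lt f g0 by (simp add: hat_def field_simps)
          moreover have "inner (hat f - hat g) (hat f - hat g) = 2 - 2 * inner (hat f) (hat g)"
            using hat(3)[OF f] hat(3)[OF that(2) g0] by (rule inner_diff_unit)
          ultimately have "(norm (hat f - hat g))\<^sup>2 < \<delta>\<^sup>2"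
            using elim by (simp add: dot_square_norm)
          then have "dist (hat f) (hat g) < \<delta>"
            using \<delta>(1) by (simp add: dist_norm power_less_imp_less_base)
          then have "hat g \<in> N" using \<delta>(2) by auto
          then show ?thesis using N(2)[of "norm (X g)" "hat g"] g0 by (simp add: hat_def)
        qed
        have "(\<integral>\<^sup>+ g. k j f g * indicator ?N g \<partial>\<mu>) = (\<integral>\<^sup>+ g. k j f g \<partial>\<mu>)"
          using in_N by (intro nn_integral_cong) (force split: split_indicator)
        then show ?case
          using B[of j] kB'[OF f, of j] by (simp add: G_def less_top)
      qed
      then have "eventually (\<lambda>j. ennreal (norm (X f)) \<le> ennreal (norm (X f)) * G j f) sequentially"
        by eventually_elim simp
      then have "ennreal (norm (X f)) \<le> liminf (\<lambda>j. ennreal (norm (X f)) * G j f)"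
        by (rule Liminf_bounded)
      then show ?thesis using True f by simp
    qed simp
  qed
  \<comment> \<open>Fatou's lemma gives only an inequality; equality comes later from the
    complementary cone.\<close>
  also have "\<dots> \<le> liminf (\<lambda>j. \<integral>\<^sup>+ f. ennreal (norm (X f)) * G j f \<partial>\<mu>)"
    by (rule nn_integral_liminf) measurable
  also have "\<dots> = ?\<rho> * emeasure \<mu> ?N" by (simp add: G_int Liminf_const)
  finally show ?thesis .
qed

text \<open>The one-sided estimate holds for both \<open>N\<close> and \<open>N'\<close>. Summed
  over the two cones, each side gives the mean norm, so neither estimate can be strict.\<close>

lemma expectation_norm_open_cone:
  assumes ne: "AE f in \<mu>. X f \<noteq> 0"
    and N: "open N" "\<And>r z. 0 < r \<Longrightarrow> z \<in> N \<Longrightarrow> r *\<^sub>R z \<in> N" "Measurable.pred \<mu> (\<lambda>f. X f \<in> N)"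
    and N': "open N'" "\<And>r z. 0 < r \<Longrightarrow> z \<in> N' \<Longrightarrow> r *\<^sub>R z \<in> N'" "Measurable.pred \<mu> (\<lambda>f. X f \<in> N')"
    and disj: "N \<inter> N' = {}" and cover: "AE f in \<mu>. X f \<in> N \<union> N'"
  shows "expectation (\<lambda>f. norm (X f) * indicator {f\<in>space \<mu>. X f \<in> N} f)
     = expectation (\<lambda>f. norm (X f)) * prob {f\<in>space \<mu>. X f \<in> N}"
proof -
  note [measurable] = N(3) N'(3)
  have int: "integrable \<mu> (\<lambda>f. norm (X f) * indicator {f\<in>space \<mu>. X f \<in> A} f)"
    if [measurable]: "Measurable.pred \<mu> (\<lambda>f. X f \<in> A)" for A
  proof (rule integrable_const_bound[of _ C])
    show "AE f in \<mu>. norm (norm (X f) * indicator {f\<in>space \<mu>. X f \<in> A} f) \<le> C"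
    proof (rule AE_I2)
      fix f assume "f \<in> space \<mu>"
      then have "norm (X f) \<le> C" "0 \<le> C"
        using X_bound[of f] order_trans[OF norm_ge_zero X_bound[of f]] by (auto simp: space_frames)
      then show "norm (norm (X f) * indicator {f\<in>space \<mu>. X f \<in> A} f) \<le> C"
        by (simp split: split_indicator)
    qed
  qed measurable
  have int1: "integrable \<mu> (\<lambda>f. norm (X f))"
    by (rule integrable_const_bound[of _ C]) (use X_bound in \<open>auto simp: space_frames intro!: AE_I2\<close>)
  have le: "expectation (\<lambda>f. norm (X f) * indicator {f\<in>space \<mu>. X f \<in> A} f)
     \<le> expectation (\<lambda>f. norm (X f)) * prob {f\<in>space \<mu>. X f \<in> A}"
    if A: "open A" "\<And>r z. 0 < r \<Longrightarrow> z \<in> A \<Longrightarrow> r *\<^sub>R z \<in> A" "Measurable.pred \<mu> (\<lambda>f. X f \<in> A)" for A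
  proof -
    have "ennreal (expectation (\<lambda>f. norm (X f) * indicator {f\<in>space \<mu>. X f \<in> A} f))
      = (\<integral>\<^sup>+ f. ennreal (norm (X f)) * indicator {f\<in>space \<mu>. X f \<in> A} f \<partial>\<mu>)"
      by (subst nn_integral_eq_integral[OF int[OF A(3)], symmetric])
         (auto simp: ennreal_mult ennreal_indicator)
    also have "\<dots> \<le> (\<integral>\<^sup>+ f. ennreal (norm (X f)) \<partial>\<mu>) * emeasure \<mu> {f\<in>space \<mu>. X f \<in> A}"
      by (rule nn_integral_norm_open_cone_le[OF ne A])
    also have "\<dots> = ennreal (expectation (\<lambda>f. norm (X f)) * prob {f\<in>space \<mu>. X f \<in> A})"
      by (subst nn_integral_eq_integral[OF int1]) (auto simp: emeasure_eq_measure ennreal_mult)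
    finally show ?thesis
      by (subst (asm) ennreal_le_iff) (auto intro!: mult_nonneg_nonneg integral_nonneg)
  qed
  have sum_eq: "expectation (\<lambda>f. norm (X f) * indicator {f\<in>space \<mu>. X f \<in> N} f)
      + expectation (\<lambda>f. norm (X f) * indicator {f\<in>space \<mu>. X f \<in> N'} f) = expectation (\<lambda>f. norm (X f))"
  proof -
    have "expectation (\<lambda>f. norm (X f)) = expectation (\<lambda>f. norm (X f) * indicator {f\<in>space \<mu>. X f \<in> N} f
       + norm (X f) * indicator {f\<in>space \<mu>. X f \<in> N'} f)"
      by (rule integral_cong_AE, measurable)
         (rule AE_mp[OF cover], rule AE_I2, use disj in \<open>auto split: split_indicator\<close>)
    then show ?thesis by (subst (asm) Bochner_Integration.integral_add) (auto intro!: int N N')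
  qed
  have "prob {f\<in>space \<mu>. X f \<in> N} + prob {f\<in>space \<mu>. X f \<in> N'} = 1"
  proof -
    have "prob ({f\<in>space \<mu>. X f \<in> N} \<union> {f\<in>space \<mu>. X f \<in> N'})
       = prob {f\<in>space \<mu>. X f \<in> N} + prob {f\<in>space \<mu>. X f \<in> N'}"
      by (rule finite_measure_Union) (use disj in auto)
    moreover have "prob ({f\<in>space \<mu>. X f \<in> N} \<union> {f\<in>space \<mu>. X f \<in> N'}) = 1"
    proof (rule prob_eq_1[THEN iffD2])
      show "AE f in \<mu>. f \<in> {f\<in>space \<mu>. X f \<in> N} \<union> {f\<in>space \<mu>. X f \<in> N'}"
        by (rule AE_mp[OF cover], rule AE_I2) auto
    qed measurable
    ultimately show ?thesis by simp
  qed
  then have "expectation (\<lambda>f. norm (X f)) * prob {f\<in>space \<mu>. X f \<in> N'}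
      = expectation (\<lambda>f. norm (X f)) - expectation (\<lambda>f. norm (X f)) * prob {f\<in>space \<mu>. X f \<in> N}"
    by (simp add: eq_diff_eq add.commute flip: distrib_left)
  then show ?thesis
    using le[OF N] le[OF N'] sum_eq by linarith
qed

end

section \<open>Integrals over frames and the vector \<open>frame_cross\<close>\<close>

lemma frame_integrable:
  fixes g :: "fin_seq \<times> fin_seq \<Rightarrow> real"
  assumes \<mu>: "uniform_2_frame n \<mu>" and "continuous_on UNIV g"
    and "\<And>f. f \<in> orthonormal_2_frames n \<Longrightarrow> \<bar>g f\<bar> \<le> K"
  shows "integrable \<mu> g"
proof -
  interpret prob_space \<mu> using \<mu> by (simp add: uniform_2_frame_def)
  show ?thesis
    by (rule integrable_const_bound[of _ K])
       (use assms in \<open>auto intro!: AE_I2 frame_measurable[OF \<mu>] simp: uniform_2_frame_def\<close>)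
qed

lemma frame_integral_invariant:
  fixes g :: "fin_seq \<times> fin_seq \<Rightarrow> real"
  assumes \<mu>: "uniform_2_frame n \<mu>" and T: "orthogonal_transformation T" "T ` R_space n = R_space n"
    and g: "g \<in> borel_measurable \<mu>"
  shows "(\<integral>f. g (map_prod T T f) \<partial>\<mu>) = (\<integral>f. g f \<partial>\<mu>)"
proof -
  have "distr \<mu> \<mu> (map_prod T T) = \<mu>" using \<mu> T by (simp add: uniform_2_frame_def)
  then show ?thesis
    using integral_distr[OF frame_map_measurable[OF \<mu> T], of g] g by simp
qed

text \<open>
  The projection of \<open>e\<close> to the plane spanned by the frame, turned by a right angle in that plane.
\<close>

definition frame_cross :: "fin_seq \<Rightarrow> fin_seq \<times> fin_seq \<Rightarrow> fin_seq" where
  "frame_cross e f = inner (fst f) e *\<^sub>R snd f - inner (snd f) e *\<^sub>R fst f"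

lemma frameD:
  assumes "f \<in> orthonormal_2_frames n"
  shows "fst f \<in> R_space n" "snd f \<in> R_space n" "norm (fst f) = 1" "norm (snd f) = 1"
    "inner (fst f) (snd f) = 0"
  using assms by (auto simp: orthonormal_2_frames_def)

lemma abs_inner_fst_frame: "f \<in> orthonormal_2_frames n \<Longrightarrow> \<bar>inner (fst f) y\<bar> \<le> norm y"
  using Cauchy_Schwarz_ineq2[of "fst f" y] by (simp add: frameD)

lemma abs_inner_snd_frame: "f \<in> orthonormal_2_frames n \<Longrightarrow> \<bar>inner (snd f) y\<bar> \<le> norm y"
  using Cauchy_Schwarz_ineq2[of "snd f" y] by (simp add: frameD)

text \<open>By orthonormality of the frame; the right-hand side is the length of the shadow of
  \<open>e\<close>.\<close>

lemma norm_frame_cross: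
  assumes "f \<in> orthonormal_2_frames n"
  shows "norm (frame_cross e f) = sqrt ((inner (fst f) e)\<^sup>2 + (inner (snd f) e)\<^sup>2)"
proof -
  have "inner (fst f) (fst f) = 1" "inner (snd f) (snd f) = 1" "inner (fst f) (snd f) = 0"
    using frameD[OF assms] by (auto simp: norm_eq_1)
  then show ?thesis
    by (simp add: norm_eq_sqrt_inner frame_cross_def inner_diff_left inner_diff_right
        inner_commute[of "snd f" "fst f"] power2_eq_square)
qed

lemma norm_frame_cross_le:
  assumes "f \<in> orthonormal_2_frames n"
  shows "norm (frame_cross e f) \<le> 2 * norm e"
  using sqrt_sum_squares_le_sum_abs[of "inner (fst f) e" "inner (snd f) e"]
    abs_inner_fst_frame[OF assms, of e] abs_inner_snd_frame[OF assms, of e]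
  by (simp add: norm_frame_cross[OF assms])

lemma continuous_on_frame_cross: "continuous_on A (frame_cross e)"
  unfolding frame_cross_def by (intro continuous_intros)

text \<open>Choosing \<open>e = 0\<close> admits every orthogonal map, so \<open>fst\<close> is
  spread evenly over all directions.\<close>

lemma equivariant_fst:
  assumes "2 \<le> n" and \<mu>: "uniform_2_frame n \<mu>"
  shows "equivariant_frame_vector n \<mu> 0 fst 1"
  by standard (use assms in \<open>auto simp: frameD subspace_0 subspace_R_space
      intro!: frame_measurable[OF \<mu>] continuous_intros\<close>)

lemma equivariant_frame_cross:
  assumes "2 \<le> n" and \<mu>: "uniform_2_frame n \<mu>" and e: "e \<in> R_space n"
  shows "equivariant_frame_vector n \<mu> e (frame_cross e) (2 * norm e)"
proof
  fix f T y
  assume f: "f \<in> orthonormal_2_frames n"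
  show "frame_cross e f \<in> R_space n"
    unfolding frame_cross_def by (intro subspace_diff subspace_scale subspace_R_space frameD[OF f])
  show "inner (frame_cross e f) e = 0"
    by (simp add: frame_cross_def inner_diff_left)
  show "norm (frame_cross e f) \<le> 2 * norm e"
    by (rule norm_frame_cross_le[OF f])
  assume T: "orthogonal_transformation T" "T ` R_space n = R_space n" "T e = e"
  have "inner (T x) e = inner x e" for x
    using T by (metis orthogonal_transformation_def)
  then show "frame_cross e (map_prod T T f) = T (frame_cross e f)"
    using T(1) by (simp add: frame_cross_def orthogonal_transformation_def linear_diff linear_scale)
next
  fix y show "(\<lambda>f. inner (frame_cross e f) y) \<in> borel_measurable \<mu>"
    by (intro frame_measurable[OF \<mu>] continuous_intros continuous_on_frame_cross)
qed (use assms in auto)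

lemma AE_inner_fst_nonzero:
  assumes "2 \<le> n" and \<mu>: "uniform_2_frame n \<mu>" and e: "e \<in> R_space n" "e \<noteq> 0"
  shows "AE f in \<mu>. inner (fst f) e \<noteq> 0"
proof -
  interpret equivariant_frame_vector n \<mu> 0 fst 1 by (rule equivariant_fst[OF assms(1,2)])
  have "fst f \<noteq> 0" if "f \<in> space \<mu>" for f
    using frameD(3)[of f n] that by (auto simp: space_frames)
  then show ?thesis
    using e by (intro AE_inner_nonzero AE_I2) auto
qed

lemma AE_frame_cross_nonzero:
  assumes "2 \<le> n" and \<mu>: "uniform_2_frame n \<mu>" and e: "e \<in> R_space n" "e \<noteq> 0"
  shows "AE f in \<mu>. frame_cross e f \<noteq> 0"
proof (rule AE_mp[OF AE_inner_fst_nonzero[OF assms]], rule AE_I2, rule impI)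
  fix f assume f: "f \<in> space \<mu>" "inner (fst f) e \<noteq> 0"
  then have "f \<in> orthonormal_2_frames n" using \<mu> by (simp add: uniform_2_frame_def)
  then show "frame_cross e f \<noteq> 0"
    using f(2) norm_frame_cross[of f n e] by (auto simp: sum_power2_eq_zero_iff)
qed

section \<open>The mean length of the shadow of a unit vector and its lower bound\<close>

definition mean_shadow_length :: "(fin_seq \<times> fin_seq) measure \<Rightarrow> real" where
  "mean_shadow_length \<mu> = (\<integral>f. norm (frame_cross (unit_seq 0) f) \<partial>\<mu>)"

lemma exists_rotation_unit_seq:
  assumes "0 < n" "y \<in> R_space n"
  obtains T where "orthogonal_transformation T" "T ` R_space n = R_space n"
    "T (norm y *\<^sub>R unit_seq 0) = y"
proof -
  have "norm y *\<^sub>R unit_seq 0 \<in> R_space n"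
    using assms by (intro subspace_scale subspace_R_space unit_seq_in_R_space)
  then show ?thesis
    using reflection_exists[of "norm y *\<^sub>R unit_seq 0" n y 0] assms that by auto
qed

text \<open>An orthogonal map carries a multiple of \<open>unit_seq 0\<close> to \<open>e\<close>,
  and the norm depends only on the products of the frame vectors with \<open>e\<close>.\<close>

lemma integral_norm_frame_cross:
  assumes "0 < n" and \<mu>: "uniform_2_frame n \<mu>" and e: "e \<in> R_space n"
  shows "(\<integral>f. norm (frame_cross e f) \<partial>\<mu>) = norm e * mean_shadow_length \<mu>"
proof -
  obtain T where T: "orthogonal_transformation T" "T ` R_space n = R_space n"
    "T (norm e *\<^sub>R unit_seq 0) = e"
    using exists_rotation_unit_seq[OF assms(1) e] .
  have iso: "inner (T x) (T y) = inner x y" for x y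
    using T(1) by (simp add: orthogonal_transformation_def)
  have sp: "space \<mu> = orthonormal_2_frames n" using \<mu> by (simp add: uniform_2_frame_def)
  have "(\<integral>f. norm (frame_cross e f) \<partial>\<mu>) = (\<integral>f. norm (frame_cross e (map_prod T T f)) \<partial>\<mu>)"
    by (rule frame_integral_invariant[OF \<mu> T(1,2), symmetric])
       (intro frame_measurable[OF \<mu>] continuous_intros continuous_on_frame_cross)
  also have "\<dots> = (\<integral>f. norm e * norm (frame_cross (unit_seq 0) f) \<partial>\<mu>)"
  proof (rule Bochner_Integration.integral_cong[OF refl])
    fix f assume "f \<in> space \<mu>"
    then have f: "f \<in> orthonormal_2_frames n" using sp by simp
    have Tf: "map_prod T T f \<in> orthonormal_2_frames n"
      using measurable_space[OF frame_map_measurable[OF \<mu> T(1,2)], of f] f sp by simp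
    have "inner (T x) e = norm e * inner x (unit_seq 0)" for x
      using iso[of x "norm e *\<^sub>R unit_seq 0"] T(3) by simp
    then show "norm (frame_cross e (map_prod T T f)) = norm e * norm (frame_cross (unit_seq 0) f)"
      unfolding norm_frame_cross[OF Tf] norm_frame_cross[OF f]
      by (simp add: power_mult_distrib real_sqrt_mult flip: distrib_left)
  qed
  finally show ?thesis by (simp add: mean_shadow_length_def)
qed

lemma integral_inner_fst_invariant:
  fixes \<psi> :: "real \<Rightarrow> real"
  assumes "0 < n" and \<mu>: "uniform_2_frame n \<mu>" and y: "y \<in> R_space n" "norm y = 1"
    and \<psi>: "continuous_on UNIV \<psi>"
  shows "(\<integral>f. \<psi> (inner (fst f) y) \<partial>\<mu>) = (\<integral>f. \<psi> (inner (fst f) (unit_seq 0)) \<partial>\<mu>)"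
proof -
  obtain T where T: "orthogonal_transformation T" "T ` R_space n = R_space n"
    "T (norm y *\<^sub>R unit_seq 0) = y"
    using exists_rotation_unit_seq[OF assms(1) y(1)] .
  have "inner (T x) (T z) = inner x z" for x z
    using T(1) by (simp add: orthogonal_transformation_def)
  then have iso: "inner (T x) y = inner x (unit_seq 0)" for x
    using T(3) y(2) by (metis scaleR_one)
  have "(\<integral>f. \<psi> (inner (fst f) y) \<partial>\<mu>) = (\<integral>f. \<psi> (inner (fst (map_prod T T f)) y) \<partial>\<mu>)"
    by (rule frame_integral_invariant[OF \<mu> T(1,2), symmetric])
       (intro frame_measurable[OF \<mu>] continuous_on_compose2[OF \<psi>] continuous_intros subset_UNIV)
  then show ?thesis by (simp add: iso)
qed

text \<open>The shadow of \<open>unit_seq 0\<close> is at least as long as the coordinate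
  \<open>x 0\<close> of the first frame vector. Its mean absolute value is bounded below by the mean
  of an even polynomial, known from the second moment \<open>1 / n\<close> and the fourth moment
  \<open>3 / (n * (n + 2))\<close>.\<close>

lemma mean_shadow_length_ge:
  assumes n: "2 \<le> n" and \<mu>: "uniform_2_frame n \<mu>"
  shows "9 / 16 / sqrt (real n) \<le> mean_shadow_length \<mu>"
proof -
  interpret prob_space \<mu> using \<mu> by (simp add: uniform_2_frame_def)
  have sp: "space \<mu> = orthonormal_2_frames n" using \<mu> by (simp add: uniform_2_frame_def)
  have n0: "0 < n" using n by simp
  define x where "x i f = inner (fst f) (unit_seq i)" for i :: nat and f :: "fin_seq \<times> fin_seq"
  have xc [continuous_intros]: "continuous_on A (x i)" for A i
    unfolding x_def by (intro continuous_intros)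
  have x1: "\<bar>x i f\<bar> \<le> 1" if "f \<in> orthonormal_2_frames n" for i f
    using abs_inner_fst_frame[OF that, of "unit_seq i"] by (simp add: x_def)
  have pow_le: "\<bar>x i f ^ k\<bar> \<le> 1" if "f \<in> orthonormal_2_frames n" for i f k
    using x1[OF that, of i] by (simp add: power_abs power_le_one)
  have int_pow: "integrable \<mu> (\<lambda>f. x i f ^ k)" for i k
    by (rule frame_integrable[OF \<mu>]) (auto intro!: continuous_intros pow_le)
  have int_mul: "integrable \<mu> (\<lambda>f. x i f ^ k * x j f ^ l)" for i j k l
    by (rule frame_integrable[OF \<mu>, where K = 1])
       (auto intro!: continuous_intros mult_le_one pow_le[unfolded power_abs] simp: abs_mult power_abs)
  have int_abs: "integrable \<mu> (\<lambda>f. \<bar>x i f\<bar>)" for i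
    by (rule frame_integrable[OF \<mu>, where K = 1]) (auto intro!: continuous_intros x1)
  have sum1: "(\<Sum>i<n. x i f ^ 2) = 1" if "f \<in> space \<mu>" for f
    using that frameD[of f n] norm_R_space[of "fst f" n] by (simp add: x_def inner_unit_seq sp)
  define a where "a = expectation (\<lambda>f. x 0 f ^ 4)"
  have pow_inv: "expectation (\<lambda>f. x i f ^ k) = expectation (\<lambda>f. x 0 f ^ k)" if "i < n" for i k
    unfolding x_def
    by (rule integral_inner_fst_invariant[OF n0 \<mu>, of "unit_seq i" "\<lambda>t. t ^ k"])
       (auto intro!: continuous_intros unit_seq_in_R_space that)
  have a2: "expectation (\<lambda>f. x 0 f ^ 2) = 1 / n"
  proof -
    have "1 = expectation (\<lambda>f. \<Sum>i<n. x i f ^ 2)"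
      by (subst Bochner_Integration.integral_cong[OF refl sum1]) (auto simp: prob_space)
    also have "\<dots> = (\<Sum>i<n. expectation (\<lambda>f. x i f ^ 2))"
      by (rule Bochner_Integration.integral_sum) (rule int_pow)
    also have "\<dots> = (\<Sum>i<n. expectation (\<lambda>f. x 0 f ^ 2))"
      by (rule sum.cong[OF refl]) (rule pow_inv, simp)
    finally show ?thesis using n by (simp add: field_simps)
  qed
  \<comment> \<open>By invariance \<open>(x 0 + x i) / sqrt 2\<close> and
    \<open>(x 0 - x i) / sqrt 2\<close> also have fourth moment \<open>a\<close>. Adding their
    fourth powers cancels the odd terms and leaves a linear equation for the mixed moment.\<close>
  have mixed: "expectation (\<lambda>f. x 0 f ^ 2 * x i f ^ 2) = a / 3" if i: "i < n" "i \<noteq> 0" for i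
  proof -
    have rot: "expectation (\<lambda>f. ((x 0 f + s * x i f) / sqrt 2) ^ 4) = a" if s: "s\<^sup>2 = 1" for s
    proof -
      define y where "y = (1 / sqrt 2) *\<^sub>R (unit_seq 0 + s *\<^sub>R unit_seq i)"
      have "inner (unit_seq 0) (unit_seq i) = 0" "inner (unit_seq i) (unit_seq 0) = 0"
        using i by (auto simp: inner_unit_seq unit_seq.rep_eq)
      moreover have "inner (unit_seq j) (unit_seq j) = 1" for j
        by (simp add: inner_unit_seq unit_seq.rep_eq)
      ultimately have "inner y y = 1"
        using s by (simp add: y_def inner_add_left inner_add_right power2_eq_square)
      then have y: "norm y = 1" by (simp add: norm_eq_1)
      have "y \<in> R_space n" unfolding y_def
        using i n by (intro subspace_scale subspace_add subspace_R_space unit_seq_in_R_space) auto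
      then have "expectation (\<lambda>f. inner (fst f) y ^ 4) = a"
        unfolding a_def x_def
        by (intro integral_inner_fst_invariant[OF n0 \<mu>, of y "\<lambda>t. t ^ 4"] y continuous_intros)
      then show ?thesis by (simp add: y_def x_def inner_add_right)
    qed
    have "((x 0 f + 1 * x i f) / sqrt 2) ^ 4 + ((x 0 f + (-1) * x i f) / sqrt 2) ^ 4
       = (x 0 f ^ 4 + 6 * (x 0 f ^ 2 * x i f ^ 2) + x i f ^ 4) / 2" for f
    proof -
      have "sqrt 2 ^ 4 = (4::real)" by (simp add: power4_eq_xxxx)
      then show ?thesis unfolding power_divide
        by (simp add: power4_eq_xxxx power2_eq_square field_simps)
    qed
    then have "expectation (\<lambda>f. ((x 0 f + 1 * x i f) / sqrt 2) ^ 4 + ((x 0 f + (-1) * x i f) / sqrt 2) ^ 4)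
       = expectation (\<lambda>f. (x 0 f ^ 4 + 6 * (x 0 f ^ 2 * x i f ^ 2) + x i f ^ 4) / 2)" by (simp only:)
    moreover have "expectation (\<lambda>f. ((x 0 f + 1 * x i f) / sqrt 2) ^ 4 + ((x 0 f + (-1) * x i f) / sqrt 2) ^ 4) = a + a"
    proof -
      have "integrable \<mu> (\<lambda>f. ((x 0 f + s * x i f) / sqrt 2) ^ 4)" if "\<bar>s\<bar> = 1" for s
      proof (rule frame_integrable[OF \<mu>, where K = "2 ^ 4"])
        show "continuous_on UNIV (\<lambda>f. ((x 0 f + s * x i f) / sqrt 2) ^ 4)"
          by (auto intro!: continuous_intros)
        fix f assume f: "f \<in> orthonormal_2_frames n"
        have "\<bar>x 0 f + s * x i f\<bar> \<le> 2"
          using x1[OF f, of 0] x1[OF f, of i] that abs_triangle_ineq[of "x 0 f" "s * x i f"]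
          by (simp add: abs_mult)
        then have "\<bar>(x 0 f + s * x i f) / sqrt 2\<bar> \<le> 2"
          by (simp add: field_simps) (smt (verit) real_sqrt_ge_1_iff)
        then show "\<bar>((x 0 f + s * x i f) / sqrt 2) ^ 4\<bar> \<le> 2 ^ 4"
          unfolding power_abs by (intro power_mono) auto
      qed
      from this[of 1] this[of "-1"] show ?thesis
        using rot[of 1] rot[of "-1"] by (subst Bochner_Integration.integral_add) simp_all
    qed
    moreover have "expectation (\<lambda>f. (x 0 f ^ 4 + 6 * (x 0 f ^ 2 * x i f ^ 2) + x i f ^ 4) / 2)
        = (a + 6 * expectation (\<lambda>f. x 0 f ^ 2 * x i f ^ 2) + a) / 2"
      using int_pow int_mul pow_inv[OF i(1), of 4] by (simp add: a_def)
    ultimately show ?thesis by simp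
  qed
  have a: "a = 3 / (n * (n + 2))"
  proof -
    \<comment> \<open>The identity \<open>sum1\<close>, multiplied by \<open>x 0 f ^ 2\<close> and
      integrated, gives \<open>1 / n = a + (n - 1) * a / 3\<close>.\<close>
    have "1 / n = expectation (\<lambda>f. \<Sum>i<n. x 0 f ^ 2 * x i f ^ 2)"
      unfolding a2[symmetric]
      by (rule Bochner_Integration.integral_cong[OF refl]) (simp add: sum1 flip: sum_distrib_left)
    also have "\<dots> = (\<Sum>i<n. expectation (\<lambda>f. x 0 f ^ 2 * x i f ^ 2))"
      by (rule Bochner_Integration.integral_sum) (rule int_mul)
    also have "\<dots> = expectation (\<lambda>f. x 0 f ^ 2 * x 0 f ^ 2) + (\<Sum>i\<in>{..<n} - {0}. expectation (\<lambda>f. x 0 f ^ 2 * x i f ^ 2))"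
      using n0 by (subst sum.remove[of _ 0]) auto
    also have "(\<Sum>i\<in>{..<n} - {0}. expectation (\<lambda>f. x 0 f ^ 2 * x i f ^ 2)) = (real n - 1) * (a / 3)"
    proof -
      have "(\<Sum>i\<in>{..<n} - {0}. expectation (\<lambda>f. x 0 f ^ 2 * x i f ^ 2)) = (\<Sum>i\<in>{..<n} - {0}. a / 3)"
        by (rule sum.cong[OF refl]) (rule mixed, auto)
      then show ?thesis using n0 by (simp add: of_nat_diff)
    qed
    also have "expectation (\<lambda>f. x 0 f ^ 2 * x 0 f ^ 2) = a"
      by (simp add: a_def flip: power_add)
    finally have "1 / n = a * (n + 2) / 3" by (simp add: field_simps)
    then have "a * (n * (n + 2)) = 3" using n by (simp add: field_simps)
    moreover have "real (n * (n + 2)) \<noteq> 0" using n unfolding of_nat_eq_0_iff by simp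
    ultimately show ?thesis by (metis nonzero_mult_div_cancel_right)
  qed
  define r where "r = sqrt (real n)"
  have r: "r > 0" "r\<^sup>2 = n" "r ^ 4 = (real n)\<^sup>2"
    using n by (auto simp: r_def power4_eq_xxxx power2_eq_square)
  \<comment> \<open>For \<open>t = r / 2 * \<bar>x 0 f\<bar>\<close> the mean of
    \<open>t\<^sup>2\<close> is \<open>1 / 4\<close> and that of \<open>t ^ 4\<close> is at most
    \<open>3 / 16\<close>; \<open>9 / 32\<close> is \<open>(3 / 4 - 3 / 16) / 2\<close>.\<close>
  have "9 / 32 \<le> (3 * (r / 2)\<^sup>2 * (1 / n) - (r / 2) ^ 4 * a) / 2"
  proof -
    have pos: "0 < real (n * (n + 2))" using n unfolding of_nat_0_less_iff by simp
    have "(real n)\<^sup>2 \<le> real (n * (n + 2))" by (simp add: power2_eq_square)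
    then have "(real n)\<^sup>2 * a \<le> real (n * (n + 2)) * a"
      by (rule mult_right_mono) (simp add: a)
    also have "\<dots> = 3" unfolding a using pos by (metis nonzero_mult_div_cancel_left less_irrefl times_divide_eq_right)
    finally have "(real n)\<^sup>2 * a \<le> 3" .
    then show ?thesis using n by (simp add: power_divide r)
  qed
  also have "\<dots> = expectation (\<lambda>f. (3 * (r / 2)\<^sup>2 * x 0 f ^ 2 - (r / 2) ^ 4 * x 0 f ^ 4) / 2)"
    using int_pow by (simp add: a2 flip: a_def)
  also have "\<dots> \<le> expectation (\<lambda>f. r / 2 * \<bar>x 0 f\<bar>)"
  proof (rule integral_mono)
    fix f
    define t where "t = r / 2 * \<bar>x 0 f\<bar>"
    have "t \<ge> 0" using r by (simp add: t_def)
    \<comment> \<open>For nonnegative \<open>t\<close> the polynomial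
      \<open>(3 * t\<^sup>2 - t ^ 4) / 2\<close> stays below the identity and touches it at
      \<open>t = 1\<close>.\<close>
    have "t - (3 * t\<^sup>2 - t ^ 4) / 2 = t / 2 * (t - 1)\<^sup>2 * (t + 2)"
      by (simp add: field_simps power2_eq_square power4_eq_xxxx)
    also have "\<dots> \<ge> 0" using \<open>t \<ge> 0\<close> by simp
    finally have "(3 * t\<^sup>2 - t ^ 4) / 2 \<le> t" by simp
    moreover have "t\<^sup>2 = (r / 2)\<^sup>2 * x 0 f ^ 2" "t ^ 4 = (r / 2) ^ 4 * x 0 f ^ 4"
      unfolding t_def power_mult_distrib by simp_all
    ultimately show "(3 * (r / 2)\<^sup>2 * x 0 f ^ 2 - (r / 2) ^ 4 * x 0 f ^ 4) / 2 \<le> r / 2 * \<bar>x 0 f\<bar>"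
      by (simp add: t_def mult.assoc)
  qed (use int_pow int_abs in auto)
  finally have "9 / 32 \<le> r / 2 * expectation (\<lambda>f. \<bar>x 0 f\<bar>)" by simp
  then have "9 / 16 / r \<le> expectation (\<lambda>f. \<bar>x 0 f\<bar>)" using r by (simp add: field_simps)
  also have "\<dots> \<le> expectation (\<lambda>f. norm (frame_cross (unit_seq 0) f))"
  proof (rule integral_mono)
    show "integrable \<mu> (\<lambda>f. norm (frame_cross (unit_seq 0) f))"
      by (rule frame_integrable[OF \<mu>, where K = 2])
         (use norm_frame_cross_le[of _ n "unit_seq 0"] in \<open>auto intro!: continuous_intros continuous_on_frame_cross\<close>)
    fix f assume "f \<in> space \<mu>"
    then show "\<bar>x 0 f\<bar> \<le> norm (frame_cross (unit_seq 0) f)"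
      by (simp add: sp norm_frame_cross x_def real_sqrt_abs[symmetric] del: real_sqrt_abs)
  qed (rule int_abs)
  finally show ?thesis by (simp add: mean_shadow_length_def r_def)
qed

section \<open>Shadows\<close>

text \<open>Orientation in the shadow is linear in the \<open>frame_cross\<close> vector, so
  visibility of \<open>(a, b)\<close> means that this vector lies in a cone independent of the
  frame.\<close>

lemma orient_frame:
  "orient (inner (fst f)) (inner (snd f)) a b x = inner (frame_cross (b - a) f) (x - a)"
  by (simp add: orient_def frame_cross_def inner_diff_left inner_diff_right algebra_simps)

lemma sqrt_frame:
  assumes "f \<in> orthonormal_2_frames n"
  shows "sqrt ((inner (fst f) b - inner (fst f) a)\<^sup>2 + (inner (snd f) b - inner (snd f) a)\<^sup>2)
    = norm (frame_cross (b - a) f)"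
  by (simp add: norm_frame_cross[OF assms] inner_diff_right)

section \<open>Extreme points of a shadow and measurability of their number\<close>

lemma shadow_convex_hull:
  "shadow (convex hull S) f = convex hull ((\<lambda>x. (inner (fst f) x, inner (snd f) x)) ` S)"
proof -
  have "linear (\<lambda>x. (inner (fst f) x, inner (snd f) x))"
    by (rule linearI) (auto simp: inner_add_right)
  then show ?thesis
    by (simp add: shadow_def case_prod_unfold convex_hull_linear_image)
qed

text \<open>
  The set \<open>A\<close> collects points with the same image as \<open>a\<close>. For fixed \<open>A\<close> the last condition is open
  in \<open>f\<close>, which makes the number of vertices of the shadow Borel measurable on all frames,
  degenerate ones included.
\<close>

definition separated_vertex :: "fin_seq set \<Rightarrow> fin_seq \<times> fin_seq \<Rightarrow> fin_seq \<Rightarrow> bool" where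
  "separated_vertex S f a \<longleftrightarrow> (\<exists>A\<in>Pow S.
     (\<forall>x\<in>A. inner (fst f) x = inner (fst f) a \<and> inner (snd f) x = inner (snd f) a) \<and>
     (\<exists>p q. \<forall>x\<in>S - A. 0 < p * inner (fst f) (x - a) + q * inner (snd f) (x - a)))"

lemma extreme_points_of_shadow:
  assumes "finite S"
  shows "{p. p extreme_point_of shadow (convex hull S) f}
    = (\<lambda>x. (inner (fst f) x, inner (snd f) x)) ` {a\<in>S. separated_vertex S f a}"
proof -
  let ?\<pi> = "\<lambda>x. (inner (fst f) x, inner (snd f) x)"
  have "?\<pi> a extreme_point_of convex hull (?\<pi> ` S) \<longleftrightarrow> separated_vertex S f a" if a: "a \<in> S" for a
  proof -
    have "?\<pi> a extreme_point_of convex hull (?\<pi> ` S) \<longleftrightarrow>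
       (\<exists>p q. \<forall>x\<in>S. ?\<pi> x \<noteq> ?\<pi> a \<longrightarrow> 0 < p * inner (fst f) (x - a) + q * inner (snd f) (x - a))"
    proof -
      have "(\<forall>y\<in>?\<pi> ` S - {?\<pi> a}. 0 < inner w (y - ?\<pi> a)) \<longleftrightarrow>
          (\<forall>x\<in>S. ?\<pi> x \<noteq> ?\<pi> a \<longrightarrow> 0 < fst w * inner (fst f) (x - a) + snd w * inner (snd f) (x - a))" for w
      proof -
        have "(\<forall>y\<in>?\<pi> ` S - {?\<pi> a}. 0 < inner w (y - ?\<pi> a)) \<longleftrightarrow>
            (\<forall>x\<in>S. ?\<pi> x \<noteq> ?\<pi> a \<longrightarrow> 0 < inner w (?\<pi> x - ?\<pi> a))"
          by blast
        then show ?thesis by (simp add: inner_prod_def inner_diff_right)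
      qed
      then show ?thesis
        using assms a by (simp add: extreme_point_of_convex_hull_finite_iff split_paired_Ex)
    qed
    also have "\<dots> \<longleftrightarrow> separated_vertex S f a"
    proof
      assume "\<exists>p q. \<forall>x\<in>S. ?\<pi> x \<noteq> ?\<pi> a \<longrightarrow> 0 < p * inner (fst f) (x - a) + q * inner (snd f) (x - a)"
      then show "separated_vertex S f a"
        unfolding separated_vertex_def by (intro bexI[of _ "{x\<in>S. ?\<pi> x = ?\<pi> a}"]) auto
    next
      assume "separated_vertex S f a"
      then show "\<exists>p q. \<forall>x\<in>S. ?\<pi> x \<noteq> ?\<pi> a \<longrightarrow> 0 < p * inner (fst f) (x - a) + q * inner (snd f) (x - a)"
        unfolding separated_vertex_def by (metis DiffI)
    qed
    finally show ?thesis .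
  qed
  then show ?thesis
    unfolding shadow_convex_hull using extreme_point_of_convex_hull by fastforce
qed

text \<open>The quantifiers over real \<open>p\<close> and \<open>q\<close> are uncountable, but
  they produce a union of open sets. The quantifier over \<open>A\<close> is finite.\<close>

lemma separated_vertex_measurable:
  assumes \<mu>: "uniform_2_frame n \<mu>" and S: "finite S"
  shows "Measurable.pred \<mu> (\<lambda>f. separated_vertex S f a)"
proof -
  have [measurable]: "(\<lambda>f. inner (fst f) x) \<in> borel_measurable \<mu>" "(\<lambda>f. inner (snd f) x) \<in> borel_measurable \<mu>" for x
    by (intro frame_measurable[OF \<mu>] continuous_intros)+
  have sp: "space \<mu> = orthonormal_2_frames n"
    and sets: "sets \<mu> = sets (restrict_space borel (orthonormal_2_frames n))"
    using \<mu> by (simp_all add: uniform_2_frame_def)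
  have [measurable]: "Measurable.pred \<mu>
      (\<lambda>f. \<exists>p q. \<forall>x\<in>S - A. 0 < p * inner (fst f) (x - a) + q * inner (snd f) (x - a))" for A
  proof -
    let ?U = "\<Union>p. \<Union>q. \<Inter>x\<in>S - A. {f. 0 < p * inner (fst f) (x - a) + q * inner (snd f) (x - a)}"
    have "open ?U"
      using S by (intro open_UN ballI open_INT open_Collect_less continuous_intros) auto
    then have "orthonormal_2_frames n \<inter> ?U \<in> sets \<mu>"
      unfolding sets sets_restrict_space by (intro imageI borel_open)
    moreover have "orthonormal_2_frames n \<inter> ?U = {f\<in>space \<mu>. \<exists>p q. \<forall>x\<in>S - A. 0 < p * inner (fst f) (x - a) + q * inner (snd f) (x - a)}"
      by (auto simp: sp)
    ultimately show ?thesis by (simp add: pred_def)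
  qed
  have [measurable]: "Measurable.pred \<mu> (\<lambda>f. \<forall>x\<in>A. inner (fst f) x = inner (fst f) a \<and> inner (snd f) x = inner (snd f) a)"
    if "A \<in> Pow S" for A
    using finite_subset[of A S] that S by (intro pred_intros_finite) auto
  show ?thesis
    unfolding separated_vertex_def using S by (intro pred_intros_finite) auto
qed

text \<open>Choosing \<open>k\<close> representatives with distinct images turns a bound on the size
  of a varying image into a finite combination of conditions on fixed subsets of \<open>S\<close>,
  as measurability requires.\<close>

lemma le_card_image_iff:
  assumes "finite S"
  shows "k \<le> card (g ` {a\<in>S. Q a}) \<longleftrightarrow>
    (\<exists>B\<in>{B\<in>Pow S. card B = k}. (\<forall>a\<in>B. Q a) \<and> (\<forall>a\<in>B. \<forall>b\<in>B. a \<noteq> b \<longrightarrow> g a \<noteq> g b))"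
proof
  assume "k \<le> card (g ` {a\<in>S. Q a})"
  then obtain D where D: "D \<subseteq> g ` {a\<in>S. Q a}" "card D = k"
    using obtain_subset_with_card_n by blast
  then obtain B where B: "B \<subseteq> {a\<in>S. Q a}" "inj_on g B" "g ` B = D"
    using subset_image_inj[of D g "{a\<in>S. Q a}"] by auto
  then show "\<exists>B\<in>{B\<in>Pow S. card B = k}. (\<forall>a\<in>B. Q a) \<and> (\<forall>a\<in>B. \<forall>b\<in>B. a \<noteq> b \<longrightarrow> g a \<noteq> g b)"
    using D(2) card_image[OF B(2)] by (intro bexI[of _ B]) (auto simp: inj_on_def)
next
  assume "\<exists>B\<in>{B\<in>Pow S. card B = k}. (\<forall>a\<in>B. Q a) \<and> (\<forall>a\<in>B. \<forall>b\<in>B. a \<noteq> b \<longrightarrow> g a \<noteq> g b)"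
  then obtain B where "B \<in> {B\<in>Pow S. card B = k}"
      and "(\<forall>a\<in>B. Q a) \<and> (\<forall>a\<in>B. \<forall>b\<in>B. a \<noteq> b \<longrightarrow> g a \<noteq> g b)"
    by (rule bexE)
  then have B: "B \<subseteq> {a\<in>S. Q a}" "card B = k" "inj_on g B"
    by (auto simp: inj_on_def)
  have "card (g ` B) \<le> card (g ` {a\<in>S. Q a})"
    using B(1) assms by (intro card_mono) auto
  then show "k \<le> card (g ` {a\<in>S. Q a})" using B by (simp add: card_image)
qed

text \<open>The integral of a non-measurable function is 0 by convention, so an almost sure formula
  for the number of vertices would not by itself determine its expectation.\<close>

lemma card_extreme_points_measurable:
  assumes \<mu>: "uniform_2_frame n \<mu>" and S: "finite S"
  shows "(\<lambda>f. real (card {p. p extreme_point_of shadow (convex hull S) f})) \<in> borel_measurable \<mu>"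
  unfolding borel_measurable_iff_ge
proof
  fix t :: real
  let ?g = "\<lambda>f x. (inner (fst f) x, inner (snd f) x)"
  let ?c = "\<lambda>f. card {p. p extreme_point_of shadow (convex hull S) f}"
  have [measurable]: "(\<lambda>f. inner (fst f) x) \<in> borel_measurable \<mu>" "(\<lambda>f. inner (snd f) x) \<in> borel_measurable \<mu>" for x
    by (intro frame_measurable[OF \<mu>] continuous_intros)+
  note separated_vertex_measurable[OF \<mu> S, measurable]
  have "Measurable.pred \<mu> (\<lambda>f. (\<forall>a\<in>B. separated_vertex S f a) \<and> (\<forall>a\<in>B. \<forall>b\<in>B. a \<noteq> b \<longrightarrow> ?g f a \<noteq> ?g f b))"
    if "B \<in> Pow S" for B
  proof -
    have "finite B" using that S finite_subset by auto
    then show ?thesis unfolding prod.inject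
      by (intro pred_intros_logic pred_intros_finite) measurable
  qed
  then have "Measurable.pred \<mu> (\<lambda>f. nat \<lceil>t\<rceil> \<le> ?c f)"
    unfolding extreme_points_of_shadow[OF S] le_card_image_iff[OF S]
    by (intro pred_intros_finite(4)) (use S in simp_all)
  moreover have "t \<le> real k \<longleftrightarrow> nat \<lceil>t\<rceil> \<le> k" for k
    by (simp add: nat_le_iff ceiling_le_iff)
  ultimately show "{f \<in> space \<mu>. t \<le> real (?c f)} \<in> sets \<mu>"
    by (simp only: pred_def)
qed

section \<open>Expected vertex number and expected perimeter of the shadow of a polytope\<close>

locale shadow_polytope =
  fixes n :: nat and \<mu> :: "(fin_seq \<times> fin_seq) measure" and S :: "fin_seq set"
  assumes n2: "2 \<le> n" and uniform: "uniform_2_frame n \<mu>"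
    and fin: "finite S" and S_sub: "S \<subseteq> R_space n"
    and irredundant: "\<And>a. a \<in> S \<Longrightarrow> a \<notin> convex hull (S - {a})"
    and two_points: "\<exists>a\<in>S. \<exists>b\<in>S. a \<noteq> b"
begin

sublocale prob_space \<mu>
  using uniform by (simp add: uniform_2_frame_def)

lemma space_frames: "space \<mu> = orthonormal_2_frames n"
  using uniform by (simp add: uniform_2_frame_def)

definition visible :: "fin_seq \<times> fin_seq \<Rightarrow> (fin_seq \<times> fin_seq) set" where
  "visible f = hull_edges (inner (fst f)) (inner (snd f)) S"

definition pairs :: "(fin_seq \<times> fin_seq) set" where
  "pairs = {(a, b). a \<in> S \<and> b \<in> S \<and> a \<noteq> b}"

definition visible_event :: "fin_seq \<times> fin_seq \<Rightarrow> (fin_seq \<times> fin_seq) set" where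
  "visible_event z = {f\<in>space \<mu>. z \<in> visible f}"

lemma finite_pairs: "finite pairs"
  by (rule finite_subset[of _ "S \<times> S"]) (auto simp: pairs_def fin)

lemma visible_subset: "visible f \<subseteq> pairs"
  by (auto simp: visible_def pairs_def hull_edges_def)

lemma mem_visible:
  assumes "(a, b) \<in> pairs"
  shows "(a, b) \<in> visible f \<longleftrightarrow> (\<forall>x\<in>S - {a, b}. 0 < inner (frame_cross (b - a) f) (x - a))"
  using assms by (auto simp: visible_def hull_edges_def orient_frame pairs_def)

lemma diff_in: "a \<in> S \<Longrightarrow> b \<in> S \<Longrightarrow> b - a \<in> R_space n"
  using S_sub by (intro subspace_diff subspace_R_space) auto

lemma inner_frame_cross_measurable [measurable]:
  "(\<lambda>f. inner (frame_cross e f) y) \<in> borel_measurable \<mu>"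
  by (intro frame_measurable[OF uniform] continuous_intros continuous_on_frame_cross)

lemma norm_frame_cross_integrable: "integrable \<mu> (\<lambda>f. norm (frame_cross e f))"
  by (rule frame_integrable[OF uniform, of _ "2 * norm e"])
     (auto intro!: continuous_intros continuous_on_frame_cross norm_frame_cross_le)

lemma visible_event_measurable [measurable]:
  assumes z: "z \<in> pairs"
  shows "visible_event z \<in> sets \<mu>"
proof -
  obtain a b where ab: "z = (a, b)" by (cases z)
  have "Measurable.pred \<mu> (\<lambda>f. \<forall>x\<in>S - {a, b}. 0 < inner (frame_cross (b - a) f) (x - a))"
    using fin by (intro pred_intros_finite) auto
  then show ?thesis
    using z unfolding visible_event_def ab mem_visible[OF z[unfolded ab]] by (simp add: pred_def)
qed

text \<open>Irredundance keeps \<open>x\<close> off the line through \<open>a\<close> and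
  \<open>b\<close>, so \<open>x - a\<close> is no multiple of \<open>b - a\<close> and is almost
  surely not orthogonal to the \<open>frame_cross\<close> vector.\<close>

lemma AE_cross_nonzero:
  assumes "(a, b) \<in> pairs"
  shows "AE f in \<mu>. \<forall>x\<in>S - {a, b}. inner (frame_cross (b - a) f) (x - a) \<noteq> 0"
proof (rule AE_finite_allI)
  have ab: "a \<in> S" "b \<in> S" "a \<noteq> b" using assms by (auto simp: pairs_def)
  interpret X: equivariant_frame_vector n \<mu> "b - a" "frame_cross (b - a)" "2 * norm (b - a)"
    by (rule equivariant_frame_cross[OF n2 uniform diff_in[OF ab(1,2)]])
  fix x assume x: "x \<in> S - {a, b}"
  show "AE f in \<mu>. inner (frame_cross (b - a) f) (x - a) \<noteq> 0"
  proof (rule X.AE_inner_nonzero)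
    show "AE f in \<mu>. frame_cross (b - a) f \<noteq> 0"
      using AE_frame_cross_nonzero[OF n2 uniform diff_in[OF ab(1,2)]] ab by simp
    show "x - a \<in> R_space n" using diff_in ab x by auto
    show "x - a \<noteq> r *\<^sub>R (b - a)" for r
      using irredundant_not_collinear[OF irredundant ab(1,2), of x r] ab x by auto
  qed
qed (use fin in auto)

text \<open>Finitely many null sets are discarded; for injectivity the first coordinate alone
  separates the points of \<open>S\<close>.\<close>

lemma AE_general_position:
  "AE f in \<mu>. general_position (inner (fst f)) (inner (snd f)) S
     \<and> inj_on (\<lambda>x. (inner (fst f) x, inner (snd f) x)) S"
proof -
  have gp: "AE f in \<mu>. \<forall>z\<in>pairs. \<forall>x\<in>S - {fst z, snd z}. inner (frame_cross (snd z - fst z) f) (x - fst z) \<noteq> 0"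
  proof (rule AE_finite_allI[OF finite_pairs])
    fix z assume "z \<in> pairs"
    then show "AE f in \<mu>. \<forall>x\<in>S - {fst z, snd z}. inner (frame_cross (snd z - fst z) f) (x - fst z) \<noteq> 0"
      using AE_cross_nonzero[of "fst z" "snd z"] by simp
  qed
  have inj: "AE f in \<mu>. \<forall>z\<in>pairs. inner (fst f) (snd z - fst z) \<noteq> 0"
    by (rule AE_finite_allI[OF finite_pairs])
       (rule AE_inner_fst_nonzero[OF n2 uniform], auto simp: pairs_def diff_in)
  from gp inj show ?thesis
  proof eventually_elim
    case (elim f)
    have "orient (inner (fst f)) (inner (snd f)) a b x \<noteq> 0"
      if "a \<in> S" "b \<in> S" "x \<in> S" "a \<noteq> b" "x \<noteq> a" "x \<noteq> b" for a b x
      using elim(1)[rule_format, of "(a, b)" x] that unfolding orient_frame by (auto simp: pairs_def)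
    moreover have "a = b" if "a \<in> S" "b \<in> S" "inner (fst f) a = inner (fst f) b" for a b
      using elim(2)[rule_format, of "(a, b)"] that by (auto simp: pairs_def inner_diff_right)
    ultimately show ?case by (auto simp: general_position_def inj_on_def)
  qed
qed

lemma expected_vertices_eq:
  "expected_shadow_vertices \<mu> (convex hull S) = (\<Sum>z\<in>pairs. prob (visible_event z))"
proof -
  have "expected_shadow_vertices \<mu> (convex hull S)
      = expectation (\<lambda>f. \<Sum>z\<in>pairs. indicator (visible_event z) f)"
    unfolding expected_shadow_vertices_def
  proof (rule integral_cong_AE)
    show "(\<lambda>f. real (card {p. p extreme_point_of shadow (convex hull S) f})) \<in> borel_measurable \<mu>"
      by (rule card_extreme_points_measurable[OF uniform fin])
    show "(\<lambda>f. \<Sum>z\<in>pairs. indicator (visible_event z) f :: real) \<in> borel_measurable \<mu>"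
      by (intro borel_measurable_sum borel_measurable_indicator visible_event_measurable)
    obtain p q where pq: "p \<in> S" "q \<in> S" "p \<noteq> q" using two_points by blast
    show "AE f in \<mu>. real (card {p. p extreme_point_of shadow (convex hull S) f})
        = (\<Sum>z\<in>pairs. indicator (visible_event z) f)"
    proof (rule AE_mp[OF AE_general_position], rule AE_I2, rule impI, elim conjE)
      fix f assume f: "f \<in> space \<mu>" and gp: "general_position (inner (fst f)) (inner (snd f)) S"
        and inj: "inj_on (\<lambda>x. (inner (fst f) x, inner (snd f) x)) S"
      have "card {p. p extreme_point_of shadow (convex hull S) f} = card (visible f)"
        unfolding shadow_convex_hull visible_def
        by (rule card_extreme_points_eq_card_hull_edges[OF fin gp inj pq])
      also have "real \<dots> = (\<Sum>z\<in>pairs. indicator (visible f) z)"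
        unfolding real_of_card
        by (rule sum.mono_neutral_cong_left) (use finite_pairs visible_subset[of f] in auto)
      also have "\<dots> = (\<Sum>z\<in>pairs. indicator (visible_event z) f)"
        using f by (intro sum.cong) (auto simp: visible_event_def split: split_indicator)
      finally show "real (card {p. p extreme_point_of shadow (convex hull S) f})
        = (\<Sum>z\<in>pairs. indicator (visible_event z) f)" .
    qed
  qed
  also have "\<dots> = (\<Sum>z\<in>pairs. expectation (indicator (visible_event z)))"
    by (rule Bochner_Integration.integral_sum)
       (auto intro!: integrable_real_indicator visible_event_measurable simp: less_top[symmetric])
  also have "\<dots> = (\<Sum>z\<in>pairs. prob (visible_event z))"
    by (intro sum.cong) (auto simp: visible_event_def Int_def intro!: arg_cong[where f = prob])
  finally show ?thesis .
qed

text \<open>Visibility of \<open>(a, b)\<close> is the event that the \<open>frame_cross\<close>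
  vector lies in the cone \<open>N\<close>, hence uncorrelated with its norm, the length of the
  shadow of the edge.\<close>

lemma expectation_visible_length:
  assumes "(a, b) \<in> pairs"
  shows "expectation (\<lambda>f. norm (frame_cross (b - a) f) * indicator (visible_event (a, b)) f)
     = norm (b - a) * mean_shadow_length \<mu> * prob (visible_event (a, b))"
proof -
  have ab: "a \<in> S" "b \<in> S" "a \<noteq> b" using assms by (auto simp: pairs_def)
  interpret X: equivariant_frame_vector n \<mu> "b - a" "frame_cross (b - a)" "2 * norm (b - a)"
    by (rule equivariant_frame_cross[OF n2 uniform diff_in[OF ab(1,2)]])
  let ?F = "S - {a, b}"
  define N where "N = {z. \<forall>x\<in>?F. 0 < inner z (x - a)}"
  \<comment> \<open>\<open>N'\<close> is the complement of \<open>N\<close> up to vectors orthogonal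
    to some \<open>x - a\<close>, which occur only on a null set.\<close>
  define N' where "N' = {z. \<exists>x\<in>?F. inner z (x - a) < 0}"
  have ev: "visible_event (a, b) = {f\<in>space \<mu>. frame_cross (b - a) f \<in> N}"
    by (simp add: visible_event_def mem_visible[OF assms] N_def)
  have "expectation (\<lambda>f. norm (frame_cross (b - a) f) * indicator {f\<in>space \<mu>. frame_cross (b - a) f \<in> N} f)
     = expectation (\<lambda>f. norm (frame_cross (b - a) f)) * prob {f\<in>space \<mu>. frame_cross (b - a) f \<in> N}"
  proof (rule X.expectation_norm_open_cone)
    show "AE f in \<mu>. frame_cross (b - a) f \<noteq> 0"
      using AE_frame_cross_nonzero[OF n2 uniform diff_in[OF ab(1,2)]] ab by simp
    have "N = (\<Inter>x\<in>?F. {z. 0 < inner z (x - a)})" by (auto simp: N_def)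
    then show "open N"
      using fin by (auto intro!: open_INT open_Collect_less continuous_intros)
    have "N' = (\<Union>x\<in>?F. {z. inner z (x - a) < 0})" by (auto simp: N'_def)
    then show "open N'"
      by (auto intro!: open_UN open_Collect_less continuous_intros)
    show "Measurable.pred \<mu> (\<lambda>f. frame_cross (b - a) f \<in> N)"
      unfolding N_def mem_Collect_eq using fin by (intro pred_intros_finite) auto
    show "Measurable.pred \<mu> (\<lambda>f. frame_cross (b - a) f \<in> N')"
      unfolding N'_def mem_Collect_eq using fin by (intro pred_intros_finite) auto
    show "N \<inter> N' = {}" by (force simp: N_def N'_def)
    show "AE f in \<mu>. frame_cross (b - a) f \<in> N \<union> N'"
      using AE_cross_nonzero[OF assms] by eventually_elim (force simp: N_def N'_def)
  qed (auto simp: N_def N'_def mult_less_0_iff)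
  then show ?thesis
    unfolding ev integral_norm_frame_cross[OF _ uniform diff_in[OF ab(1,2)]]
    using n2 integral_norm_frame_cross[OF _ uniform diff_in[OF ab(1,2)]] by simp
qed

text \<open>Indicators over the fixed set \<open>pairs\<close> replace a sum over the visible edges,
  so that expectations can be taken termwise.\<close>

definition perimeter :: "fin_seq \<times> fin_seq \<Rightarrow> real" where
  "perimeter f = (\<Sum>(a, b)\<in>pairs. norm (frame_cross (b - a) f) * indicator (visible_event (a, b)) f)"

lemma visible_length_integrable:
  assumes "(a, b) \<in> pairs"
  shows "integrable \<mu> (\<lambda>f. norm (frame_cross (b - a) f) * indicator (visible_event (a, b)) f)"
  using integrable_real_mult_indicator[OF visible_event_measurable[OF assms] norm_frame_cross_integrable[of "b - a"]] .

lemma perimeter_integrable: "integrable \<mu> perimeter"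
  unfolding perimeter_def
  by (intro Bochner_Integration.integrable_sum) (auto intro: visible_length_integrable)

lemma expectation_perimeter:
  "expectation perimeter
     = mean_shadow_length \<mu> * (\<Sum>(a, b)\<in>pairs. norm (b - a) * prob (visible_event (a, b)))"
proof -
  have "expectation perimeter
      = (\<Sum>z\<in>pairs. expectation (\<lambda>f. norm (frame_cross (snd z - fst z) f) * indicator (visible_event z) f))"
    unfolding perimeter_def case_prod_unfold prod.collapse
    by (rule Bochner_Integration.integral_sum) (use visible_length_integrable in force)
  also have "\<dots> = (\<Sum>z\<in>pairs. norm (snd z - fst z) * mean_shadow_length \<mu> * prob (visible_event z))"
    by (intro sum.cong refl) (use expectation_visible_length in force)
  finally show ?thesis by (simp add: sum_distrib_left case_prod_unfold mult_ac)
qed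

lemma perimeter_eq:
  assumes "f \<in> space \<mu>"
  shows "perimeter f = (\<Sum>(a, b)\<in>visible f. sqrt ((inner (fst f) b - inner (fst f) a)\<^sup>2
      + (inner (snd f) b - inner (snd f) a)\<^sup>2))"
  unfolding perimeter_def sqrt_frame[OF assms[unfolded space_frames]]
  by (rule sum.mono_neutral_cong_right)
     (use finite_pairs visible_subset[of f] assms in \<open>auto simp: visible_event_def\<close>)

lemma expectation_perimeter_ge:
  assumes xy: "x \<in> S" "y \<in> S"
  shows "2 * dist x y * mean_shadow_length \<mu> \<le> expectation perimeter"
proof -
  have "2 * dist x y * mean_shadow_length \<mu> = expectation (\<lambda>f. 2 * norm (frame_cross (x - y) f))"
    using n2 integral_norm_frame_cross[OF _ uniform diff_in[OF xy(2,1)]] by (simp add: dist_norm)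
  also have "\<dots> \<le> expectation perimeter"
  proof (rule integral_mono_AE[OF _ perimeter_integrable])
    show "integrable \<mu> (\<lambda>f. 2 * norm (frame_cross (x - y) f))"
      using norm_frame_cross_integrable by simp
    show "AE f in \<mu>. 2 * norm (frame_cross (x - y) f) \<le> perimeter f"
    proof (rule AE_mp[OF AE_general_position], rule AE_I2, rule impI, elim conjE)
      fix f assume f: "f \<in> space \<mu>" and gp: "general_position (inner (fst f)) (inner (snd f)) S"
      show "2 * norm (frame_cross (x - y) f) \<le> perimeter f"
        using perimeter_ge[OF fin gp xy]
        unfolding perimeter_eq[OF f] visible_def sqrt_frame[OF f[unfolded space_frames], of x y] .
    qed
  qed
  finally show ?thesis .
qed

text \<open>The frame vectors have norm 1, so both shadow coordinates vary over \<open>S\<close> by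
  at most the diameter, and \<open>perimeter_le\<close> applies almost surely.\<close>

lemma expectation_perimeter_le: "expectation perimeter \<le> 4 * diameter (convex hull S)"
proof (rule integral_le_const[OF perimeter_integrable])
  have dist: "dist x y \<le> diameter (convex hull S)" if "x \<in> S" "y \<in> S" for x y
    using that fin by (intro diameter_bounded_bound) (auto simp: finite_imp_bounded_convex_hull hull_inc)
  show "AE f in \<mu>. perimeter f \<le> 4 * diameter (convex hull S)"
  proof (rule AE_mp[OF AE_general_position], rule AE_I2, rule impI, elim conjE)
    fix f assume f: "f \<in> space \<mu>" and gp: "general_position (inner (fst f)) (inner (snd f)) S"
    have f': "f \<in> orthonormal_2_frames n" using f by (simp add: space_frames)
    have "inner (fst f) x - inner (fst f) y \<le> diameter (convex hull S)"
      "inner (snd f) x - inner (snd f) y \<le> diameter (convex hull S)" if "x \<in> S" "y \<in> S" for x y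
      using abs_inner_fst_frame[OF f', of "x - y"] abs_inner_snd_frame[OF f', of "x - y"] dist[OF that]
      by (auto simp: dist_norm inner_diff_right)
    then show "perimeter f \<le> 4 * diameter (convex hull S)"
      unfolding perimeter_eq[OF f] visible_def using two_points
      by (intro perimeter_le[OF fin gp]) auto
  qed
qed

text \<open>Positive probability provides one frame showing \<open>(a, b)\<close>; its
  \<open>frame_cross\<close> vector supports the polytope along that segment.\<close>

lemma visible_length:
  assumes z: "(a, b) \<in> pairs" and pos: "prob (visible_event (a, b)) \<noteq> 0"
  shows "norm (b - a) \<in> edge_lengths (convex hull S)"
proof -
  have "visible_event (a, b) \<noteq> {}" using pos by auto
  then obtain f where f: "(a, b) \<in> visible f" by (auto simp: visible_event_def)
  show ?thesis
    using z f[unfolded mem_visible[OF z]] fin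
    by (intro supported_pair_in_edge_lengths[where c = "frame_cross (b - a) f"])
       (auto simp: pairs_def frame_cross_def inner_diff_left)
qed

end

section \<open>Combination of the perimeter estimates into the two bounds on the number of
  vertices\<close>

theorem theorem1p1:
  shows "\<exists>c::real. \<forall>(n::nat) (P::fin_seq set) \<mu> s m M.
    n \<ge> 2 \<longrightarrow>
    polytope P \<longrightarrow> P \<subseteq> R_space n \<longrightarrow> (\<exists>e. is_edge_of e P) \<longrightarrow>
    uniform_2_frame n \<mu> \<longrightarrow>
    s = expected_shadow_vertices \<mu> P \<longrightarrow>
    m = Min (edge_lengths P) \<longrightarrow> M = Max (edge_lengths P) \<longrightarrow>
    2 / M * diameter P \<le> s \<and> s \<le> (c * sqrt (real n)) * pi / (2 * m) * diameter P"
\<comment> \<open>The estimates give \<open>9 / (16 * sqrt n) * m * s \<le> 4 * diameter P\<close>,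
  that is a factor \<open>64 / 9 * sqrt n / m\<close>; the constant solves
  \<open>c * pi / 2 = 64 / 9\<close>.\<close>
proof (rule exI[of _ "128 / (9 * pi)"], intro allI impI)
  fix n :: nat and P :: "fin_seq set" and \<mu> s m M
  assume n: "n \<ge> 2" and P: "polytope P" "P \<subseteq> R_space n" and edge: "\<exists>e. is_edge_of e P"
    and \<mu>: "uniform_2_frame n \<mu>" and s: "s = expected_shadow_vertices \<mu> P"
    and m: "m = Min (edge_lengths P)" and M: "M = Max (edge_lengths P)"
  obtain S where S: "finite S" "P = convex hull S" "\<And>a. a \<in> S \<Longrightarrow> a \<notin> convex hull (S - {a})"
    using polytope_irredundant_hull[OF P(1)] by metis
  have two: "\<exists>a\<in>S. \<exists>b\<in>S. a \<noteq> b"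
  proof (rule ccontr)
    assume "\<not> ?thesis"
    then obtain z where "S \<subseteq> {z}" by blast
    then have "P \<subseteq> {z}" unfolding S(2) by (intro hull_minimal) auto
    moreover obtain e x y where "is_edge_of e P" "x \<in> e" "y \<in> e" "x \<noteq> y"
      using edge is_edge_of_two_points by metis
    ultimately show False by (auto simp: is_edge_of_def dest!: face_of_imp_subset)
  qed
  interpret shadow_polytope n \<mu> S
    by standard (use n \<mu> S two P(2) hull_subset[of S convex] in auto)
  let ?\<kappa> = "mean_shadow_length \<mu>"
  have EL: "finite (edge_lengths P)" "edge_lengths P \<noteq> {}"
    using finite_edge_lengths[OF P(1)] edge by (auto simp: edge_lengths_def)
  have mM: "0 < m" "0 < M"
    using Min_in[OF EL] Max_in[OF EL] edge_lengths_pos[OF P(1)] by (auto simp: m M)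
  \<comment> \<open>Pairs of probability zero need not be edges of \<open>P\<close>, but they drop
    out of the sums below.\<close>
  have len: "m \<le> norm (b - a) \<and> norm (b - a) \<le> M"
    if "(a, b) \<in> pairs" "prob (visible_event (a, b)) \<noteq> 0" for a b
    using visible_length[OF that] EL unfolding m M S(2) by simp
  have \<kappa>: "9 / 16 / sqrt (real n) \<le> ?\<kappa>" by (rule mean_shadow_length_ge[OF n \<mu>])
  have "0 < 9 / 16 / sqrt (real n)" using n by simp
  then have \<kappa>0: "0 < ?\<kappa>" using \<kappa> by linarith
  let ?L = "\<Sum>(a, b)\<in>pairs. norm (b - a) * prob (visible_event (a, b))"
  have s_eq: "s = (\<Sum>z\<in>pairs. prob (visible_event z))"
    unfolding s S(2) by (rule expected_vertices_eq)
  have L_le: "?L \<le> M * s"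
    unfolding s_eq sum_distrib_left
  proof (intro sum_mono, clarify)
    fix a b assume "(a, b) \<in> pairs"
    then show "norm (b - a) * prob (visible_event (a, b)) \<le> M * prob (visible_event (a, b))"
      using len[of a b] by (cases "prob (visible_event (a, b)) = 0") (auto intro: mult_right_mono)
  qed
  have L_ge: "m * s \<le> ?L"
    unfolding s_eq sum_distrib_left
  proof (intro sum_mono, clarify)
    fix a b assume "(a, b) \<in> pairs"
    then show "m * prob (visible_event (a, b)) \<le> norm (b - a) * prob (visible_event (a, b))"
      using len[of a b] by (cases "prob (visible_event (a, b)) = 0") (auto intro: mult_right_mono)
  qed
  have "dist x y \<le> M * s / 2" if "x \<in> S" "y \<in> S" for x y
  proof -
    \<comment> \<open>The positive factor \<open>?\<kappa>\<close> cancels, so the lower bound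
      carries no constant depending on the dimension.\<close>
    have "2 * dist x y * ?\<kappa> \<le> ?\<kappa> * (M * s)"
      using expectation_perimeter_ge[OF that] mult_left_mono[OF L_le, of ?\<kappa>] \<kappa>0
      unfolding expectation_perimeter by linarith
    then show ?thesis using \<kappa>0 by (simp add: mult.commute[of ?\<kappa>])
  qed
  then have "diameter P \<le> M * s / 2"
    unfolding S(2) using two by (intro diameter_convex_hull_le) auto
  then have lower: "2 / M * diameter P \<le> s" using mM by (simp add: field_simps)
  have d0: "0 \<le> diameter P"
    unfolding S(2) using S(1) by (intro diameter_ge_0 finite_imp_bounded_convex_hull)
  have ms: "0 \<le> m * s" using mM unfolding s_eq by (simp add: sum_nonneg)
  have "9 / 16 / sqrt (real n) * (m * s) \<le> ?\<kappa> * (m * s)" by (rule mult_right_mono[OF \<kappa> ms])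
  also have "\<dots> \<le> ?\<kappa> * ?L" using mult_left_mono[OF L_ge, of ?\<kappa>] \<kappa>0 by simp
  also have "\<dots> \<le> 4 * diameter P"
    using expectation_perimeter_le unfolding expectation_perimeter S(2) .
  finally have "s \<le> (128 / (9 * pi) * sqrt (real n)) * pi / (2 * m) * diameter P"
    using mM n by (simp add: field_simps)
  then show "2 / M * diameter P \<le> s \<and> s \<le> (128 / (9 * pi) * sqrt (real n)) * pi / (2 * m) * diameter P"
    using lower by blast
qed

end
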